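(* Let $s$ be an odd positive integer and let $D$ be a normalized difference set in an abelian group $G$ with parameters \[ \left(\frac{2^{4s}-1}{2^s-1},\,\frac{2^{3s}-1}{2^s-1},\,\frac{2^{2s}-1}{2^s-1}\right). \] Then $G$ has a subgroup $M$ of order $15$ such that $D\cap M$ is a $(15,7,3)$-difference set in $M$.
   Context: A $(v,k,\lambda)$-difference set in an abelian group $G$ of order $v$ is a $k$-subset $D$ such that every non-identity element of $G$ is of the form $d_1d_2^{-1}$ with $d_1,d_2\in D$ in exactly $\lambda$ ways. It is normalized if $\prod_{d\in D}d=1$. *)

theory Defs
  imports "HOL-Algebra.Algebra"
begin

definition difference_set :: "('a, 'b) monoid_scheme \<Rightarrow> 'a set \<Rightarrow> nat \<Rightarrow> nat \<Rightarrow> nat \<Rightarrow> bool" where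
  "difference_set G D v k lam \<longleftrightarrow>
     comm_group G \<and> finite (carrier G) \<and> card (carrier G) = v \<and>
     D \<subseteq> carrier G \<and> card D = k \<and>
     (\<forall>g \<in> carrier G - {\<one>\<^bsub>G\<^esub>}.
        card {(d1, d2). d1 \<in> D \<and> d2 \<in> D \<and> d1 \<otimes>\<^bsub>G\<^esub> inv\<^bsub>G\<^esub> d2 = g} = lam)"

definition normalized_difference_set :: "('a, 'b) monoid_scheme \<Rightarrow> 'a set \<Rightarrow> bool" where
  "normalized_difference_set G D \<longleftrightarrow> finprod G (\<lambda>d. d) D = \<one>\<^bsub>G\<^esub>"

end

(* With q = 2^s the parameters are v = (q+1)(q^2+1), k = q^2+q+1, lambda = q+1, and k - lambda = q^2.

   Two facts about the group ring Z[G] of a group of odd order, both proved by iterated squaring and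
   x^2 = x^(2) mod 2, replace the usual character and ideal arguments: if 2^e divides xy then it
   divides x^(2) y, and if 2^(2e) divides x^2 then 2^e divides x. The first one, for x = D and
   y = v D^(-1) - k G, yields D^(2) D^(-1) = lambda G + (k - lambda) g, hence D^(2) = g D, and g = 1
   because D is normalized: 2 is a multiplier fixing D.

   Write G = A x B with |A| = q+1 and |B| = q^2+1. The multipliers q and q^2 act as inversion on G/B
   and G/A, so the second fact makes all intersection numbers with cosets of A and of B congruent to 1
   mod q. Counting shows that D contains A and meets every other coset of A in one point, and that D
   meets B only in 1. For b in B of order 5 the point x of D in bA is fixed by the multiplier 16;
   it has order 15 and generates M. *)
theory Submission
  imports Defs "HOL-Library.Z2" "HOL-Number_Theory.Residues"
begin

subsection \<open>Convolution of integer-valued functions\<close>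

text \<open>After passing to the two-element field the terms at \<open>x\<close> and
  \<open>h x\<close> are equal, hence cancel.\<close>

lemma even_sum_involution:
  fixes f :: "'b \<Rightarrow> int"
  assumes "\<And>x. x \<in> S \<Longrightarrow> f (h x) = f x" "\<And>x. x \<in> S \<Longrightarrow> h x \<in> S"
    "\<And>x. x \<in> S \<Longrightarrow> h (h x) = x" "\<And>x. x \<in> S \<Longrightarrow> h x \<noteq> x"
  shows "even (sum f S)"
proof -
  have *: "(of_int m :: bit) = of_bool (odd m)" for m :: int
    by (cases "even m") (auto elim!: evenE oddE)
  have "(\<Sum>x\<in>S. of_int (f x) :: bit) = 0"
    by (rule sum_involution_eq_0[where h = h]) (use assms in auto)
  then have "(of_int (sum f S) :: bit) = 0" by simp
  then show ?thesis by (simp add: * split: if_splits)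
qed

locale finite_comm_group = comm_group G for G (structure) +
  assumes finite_carrier [simp]: "finite (carrier G)"
begin

text \<open>The product of the group ring Z[G]. The value 0 off the carrier lets its ring laws hold
  as equations between functions.\<close>

definition conv :: "('a \<Rightarrow> int) \<Rightarrow> ('a \<Rightarrow> int) \<Rightarrow> 'a \<Rightarrow> int" (infixl "\<star>" 70) where
  "x \<star> y = (\<lambda>g. if g \<in> carrier G then \<Sum>h\<in>carrier G. x h * y (inv h \<otimes> g) else 0)"

lemma conv_apply: "g \<in> carrier G \<Longrightarrow> (x \<star> y) g = (\<Sum>h\<in>carrier G. x h * y (inv h \<otimes> g))"
  by (simp add: conv_def)

lemma inv_mult_cancel [simp]:
  "a \<in> carrier G \<Longrightarrow> b \<in> carrier G \<Longrightarrow> inv a \<otimes> (a \<otimes> b) = b"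
  "a \<in> carrier G \<Longrightarrow> b \<in> carrier G \<Longrightarrow> a \<otimes> (inv a \<otimes> b) = b"
  by (simp_all flip: m_assoc)

lemma inv_inv_mult [simp]: 
  "a \<in> carrier G \<Longrightarrow> b \<in> carrier G \<Longrightarrow> inv (inv a \<otimes> b) \<otimes> b = a"
  by (simp add: inv_mult m_ac)

lemma conv_comm: "x \<star> y = y \<star> x"
proof
  fix g show "(x \<star> y) g = (y \<star> x) g"
    unfolding conv_def
    by (auto intro!: sum.reindex_bij_witness[where i = "\<lambda>h. inv h \<otimes> g" and j = "\<lambda>h. inv h \<otimes> g"])
qed

lemma conv_assoc: "(x \<star> y) \<star> z = x \<star> (y \<star> z)"
proof
  fix g show "((x \<star> y) \<star> z) g = (x \<star> (y \<star> z)) g"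
  proof (cases "g \<in> carrier G")
    case True
    have "((x \<star> y) \<star> z) g
        = (\<Sum>h\<in>carrier G. \<Sum>k\<in>carrier G. x k * (y (inv k \<otimes> h) * z (inv h \<otimes> g)))"
      using True by (simp add: conv_apply sum_distrib_right mult.assoc)
    also have "\<dots> = (\<Sum>k\<in>carrier G. \<Sum>h\<in>carrier G. x k * (y (inv k \<otimes> h) * z (inv h \<otimes> g)))"
      by (rule sum.swap)
    also have "\<dots> = (\<Sum>k\<in>carrier G. \<Sum>h\<in>carrier G. x k * (y h * z (inv h \<otimes> (inv k \<otimes> g))))"
    proof (rule sum.cong[OF refl])
      fix k assume k: "k \<in> carrier G"
      show "(\<Sum>h\<in>carrier G. x k * (y (inv k \<otimes> h) * z (inv h \<otimes> g)))
          = (\<Sum>h\<in>carrier G. x k * (y h * z (inv h \<otimes> (inv k \<otimes> g))))"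
        by (rule sum.reindex_bij_witness[where i = "\<lambda>h. k \<otimes> h" and j = "\<lambda>h. inv k \<otimes> h"])
          (use k True in \<open>auto simp: inv_mult_group m_assoc\<close>)
    qed
    also have "\<dots> = (x \<star> (y \<star> z)) g"
      using True by (simp add: conv_apply sum_distrib_left)
    finally show ?thesis .
  qed (simp add: conv_def)
qed

lemma conv_lcomm: "x \<star> (y \<star> z) = y \<star> (x \<star> z)"
  by (metis conv_assoc conv_comm)

lemmas conv_ac = conv_assoc conv_comm conv_lcomm

lemma conv_add_left: "(\<lambda>g. x g + y g) \<star> z = (\<lambda>g. (x \<star> z) g + (y \<star> z) g)"
  by (auto simp: conv_def fun_eq_iff sum.distrib algebra_simps)

lemma conv_diff_left: "(\<lambda>g. x g - y g) \<star> z = (\<lambda>g. (x \<star> z) g - (y \<star> z) g)"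
  by (auto simp: conv_def fun_eq_iff sum_subtractf algebra_simps)

lemma conv_scale_left: "(\<lambda>g. c * x g) \<star> z = (\<lambda>g. c * (x \<star> z) g)"
  by (auto simp: conv_def fun_eq_iff sum_distrib_left algebra_simps)

lemma conv_add_right: "z \<star> (\<lambda>g. x g + y g) = (\<lambda>g. (z \<star> x) g + (z \<star> y) g)"
  by (simp add: conv_comm[of z] conv_add_left)

lemma conv_diff_right: "z \<star> (\<lambda>g. x g - y g) = (\<lambda>g. (z \<star> x) g - (z \<star> y) g)"
  by (simp add: conv_comm[of z] conv_diff_left)

lemma conv_scale_right: "z \<star> (\<lambda>g. c * x g) = (\<lambda>g. c * (z \<star> x) g)"
  by (simp add: conv_comm[of z] conv_scale_left)

lemmas conv_linear = conv_add_left conv_diff_left conv_scale_left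
  conv_add_right conv_diff_right conv_scale_right

lemma conv_cong:
  assumes "\<And>g. g \<in> carrier G \<Longrightarrow> x g = x' g" "\<And>g. g \<in> carrier G \<Longrightarrow> y g = y' g"
  shows "x \<star> y = x' \<star> y'"
  by (auto simp: conv_def fun_eq_iff assms intro!: sum.cong)

definition dvd_on :: "int \<Rightarrow> ('a \<Rightarrow> int) \<Rightarrow> bool" where
  "dvd_on m x \<longleftrightarrow> (\<forall>g\<in>carrier G. m dvd x g)"

lemma dvd_on_add: "dvd_on m x \<Longrightarrow> dvd_on m y \<Longrightarrow> dvd_on m (\<lambda>g. x g + y g)"
  by (simp add: dvd_on_def)

lemma dvd_on_diff: "dvd_on m x \<Longrightarrow> dvd_on m y \<Longrightarrow> dvd_on m (\<lambda>g. x g - y g)"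
  by (simp add: dvd_on_def)

lemma dvd_on_conv_right: "dvd_on m y \<Longrightarrow> dvd_on m (x \<star> y)"
  by (auto simp: dvd_on_def conv_apply intro!: dvd_sum dvd_mult)

lemma dvd_on_conv_left: "dvd_on m x \<Longrightarrow> dvd_on m (x \<star> y)"
  using dvd_on_conv_right conv_comm by metis

definition cong_on :: "int \<Rightarrow> ('a \<Rightarrow> int) \<Rightarrow> ('a \<Rightarrow> int) \<Rightarrow> bool" where
  "cong_on m x y \<longleftrightarrow> dvd_on m (\<lambda>g. x g - y g)"

lemma cong_on_refl [simp]: "cong_on m x x"
  by (simp add: cong_on_def dvd_on_def)

lemma cong_on_sym: "cong_on m x y \<Longrightarrow> cong_on m y x"
  by (simp add: cong_on_def dvd_on_def dvd_diff_commute)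

lemma cong_on_trans [trans]: "cong_on m x y \<Longrightarrow> cong_on m y z \<Longrightarrow> cong_on m x z"
  by (force simp: cong_on_def dvd_on_def dest: dvd_add)

lemma cong_on_dvd_on: "cong_on m x y \<Longrightarrow> dvd_on m y \<Longrightarrow> dvd_on m x"
  by (force simp: cong_on_def dvd_on_def dest: dvd_add)

lemma cong_on_conv:
  assumes "cong_on m x x'" "cong_on m y y'" shows "cong_on m (x \<star> y) (x' \<star> y')"
proof -
  have "dvd_on m (\<lambda>g. ((\<lambda>g. x g - x' g) \<star> y) g + (x' \<star> (\<lambda>g. y g - y' g)) g)"
    using assms by (intro dvd_on_add dvd_on_conv_left dvd_on_conv_right) (auto simp: cong_on_def)
  then show ?thesis by (simp add: cong_on_def conv_linear)
qed

definition sq :: "('a \<Rightarrow> int) \<Rightarrow> 'a \<Rightarrow> int" where "sq x = x \<star> x"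

text \<open>With x = y + 2^(k+1) z the square is y^2 + 2^(k+2) y z + 2^(2k+2) z^2. The gain of one
  power of two needs a modulus that is even already, whence \<open>Suc k\<close>.\<close>

lemma cong_on_sq_lift:
  assumes "cong_on (2 ^ Suc k) x y" shows "cong_on (2 ^ Suc (Suc k)) (sq x) (sq y)"
proof -
  define z where "z g = (x g - y g) div 2 ^ Suc k" for g
  have x: "x g = y g + 2 ^ Suc k * z g" if "g \<in> carrier G" for g
    using assms that by (simp add: cong_on_def dvd_on_def z_def)
  have "sq x = (\<lambda>g. y g + 2 ^ Suc k * z g) \<star> (\<lambda>g. y g + 2 ^ Suc k * z g)"
    unfolding sq_def by (rule conv_cong) (rule x; assumption)+
  also have "\<dots> = (\<lambda>g. sq y g + 2 ^ Suc (Suc k) * ((y \<star> z) g + 2 ^ k * (z \<star> z) g))"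
    by (simp only: sq_def conv_linear conv_comm[of z y]) (simp add: fun_eq_iff algebra_simps)
  finally show ?thesis by (simp add: cong_on_def dvd_on_def)
qed

lemma cong_on_funpow_sq_lift:
  assumes "cong_on 2 x y" shows "cong_on (2 ^ Suc n) ((sq ^^ n) x) ((sq ^^ n) y)"
  by (induction n) (use assms cong_on_sq_lift in auto)

end

subsection \<open>Frobenius congruences modulo powers of two\<close>

locale odd_comm_group = finite_comm_group +
  assumes odd_order: "odd (order G)"
begin

text \<open>Twice this exponent is \<open>order G + 1\<close>, so the map inverts squaring and is an
  endomorphism at the same time.\<close>

definition sqroot :: "'a \<Rightarrow> 'a" where "sqroot g = g [^] ((order G + 1) div 2)"

lemma sqroot_closed [simp]: "g \<in> carrier G \<Longrightarrow> sqroot g \<in> carrier G"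
  by (simp add: sqroot_def)

lemma sqroot_mult: "g \<in> carrier G \<Longrightarrow> h \<in> carrier G \<Longrightarrow> sqroot (g \<otimes> h) = sqroot g \<otimes> sqroot h"
  by (simp add: sqroot_def pow_mult_distrib m_comm)

lemma sqroot_mult_self [simp]: assumes "g \<in> carrier G" shows "sqroot g \<otimes> sqroot g = g"
proof -
  have "(order G + 1) div 2 + (order G + 1) div 2 = Suc (order G)"
    using odd_order by presburger
  then have "sqroot g \<otimes> sqroot g = g [^] Suc (order G)"
    using assms by (simp only: sqroot_def nat_pow_mult)
  then show ?thesis using assms by (simp add: pow_order_eq_1)
qed

lemma sqroot_square [simp]: "g \<in> carrier G \<Longrightarrow> sqroot (g \<otimes> g) = g"
  by (simp add: sqroot_mult)

lemma square_inj: "\<lbrakk>g \<in> carrier G; h \<in> carrier G; g \<otimes> g = h \<otimes> h\<rbrakk> \<Longrightarrow> g = h"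
  by (metis sqroot_square)

lemma sqroot_inv: "g \<in> carrier G \<Longrightarrow> sqroot (inv g) = inv (sqroot g)"
  by (simp add: sqroot_def nat_pow_inv)

text \<open>The group ring element usually written \<open>x\<^sup>(\<^sup>2\<^sup>)\<close>, that is the image of \<open>x\<close> under \<open>g \<mapsto> g\<^sup>2\<close>.\<close>

definition dilate :: "('a \<Rightarrow> int) \<Rightarrow> 'a \<Rightarrow> int" where
  "dilate x = (\<lambda>g. if g \<in> carrier G then x (sqroot g) else 0)"

lemma dilate_conv: "dilate (x \<star> y) = dilate x \<star> dilate y"
proof
  fix g show "dilate (x \<star> y) g = (dilate x \<star> dilate y) g"
  proof (cases "g \<in> carrier G")
    case True
    have "dilate (x \<star> y) g = (\<Sum>h\<in>carrier G. x h * y (inv h \<otimes> sqroot g))"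
      using True by (simp add: dilate_def conv_apply)
    also have "\<dots> = (\<Sum>h\<in>carrier G. dilate x h * dilate y (inv h \<otimes> g))"
      by (rule sum.reindex_bij_witness[where i = sqroot and j = "\<lambda>h. h \<otimes> h"])
        (use True in \<open>auto simp: dilate_def sqroot_mult sqroot_inv\<close>)
    finally show ?thesis using True by (simp add: conv_apply)
  qed (simp add: dilate_def conv_def)
qed

lemma cong_on_dilate: "cong_on m x y \<Longrightarrow> cong_on m (dilate x) (dilate y)"
  by (auto simp: cong_on_def dvd_on_def dilate_def)

lemma dvd_on_dilate_iff: "dvd_on m (dilate x) \<longleftrightarrow> dvd_on m x"
proof
  assume *: "dvd_on m (dilate x)"
  show "dvd_on m x"
    unfolding dvd_on_def
  proof
    fix g assume "g \<in> carrier G"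
    with * have "m dvd dilate x (g \<otimes> g)" unfolding dvd_on_def by blast
    then show "m dvd x g" using \<open>g \<in> carrier G\<close> by (simp add: dilate_def)
  qed
qed (simp add: dvd_on_def dilate_def)

text \<open>In the coefficient of x^2 at g the terms for h and h^(-1) g are equal. The only fixed
  point of this pairing is \<open>sqroot g\<close>; its term is a square of an integer and keeps the
  parity of that integer.\<close>

lemma cong_on_sq_dilate: "cong_on 2 (sq x) (dilate x)"
  unfolding cong_on_def dvd_on_def
proof
  fix g assume g: "g \<in> carrier G"
  have *: "inv sqroot g \<otimes> g = sqroot g"
    using g by (metis sqroot_mult_self sqroot_closed inv_mult_cancel(1))
  have "sq x g = x (sqroot g) * x (sqroot g) + (\<Sum>h\<in>carrier G - {sqroot g}. x h * x (inv h \<otimes> g))"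
    using g by (simp add: sq_def conv_apply sum.remove[of _ "sqroot g"] *)
  moreover have "even (\<Sum>h\<in>carrier G - {sqroot g}. x h * x (inv h \<otimes> g))"
  proof (rule even_sum_involution[where h = "\<lambda>h. inv h \<otimes> g"])
    fix h assume h: "h \<in> carrier G - {sqroot g}"
    show "inv (inv h \<otimes> g) \<otimes> g = h" using h g by simp
    show "x (inv h \<otimes> g) * x (inv (inv h \<otimes> g) \<otimes> g) = x h * x (inv h \<otimes> g)"
      using h g by simp
    show "inv h \<otimes> g \<noteq> h"
      using h g by (metis DiffE sqroot_square insertI1 inv_mult_cancel(2))
    then have "inv h \<otimes> g \<noteq> sqroot g"
      using h g * by (metis DiffE inv_inv_mult)
    then show "inv h \<otimes> g \<in> carrier G - {sqroot g}" using h g by simp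
  qed
  ultimately show "2 dvd sq x g - dilate x g"
    using g by (simp add: dilate_def)
qed

lemma cong_on_funpow_sq_dilate: "cong_on 2 ((sq ^^ n) x) ((dilate ^^ n) x)"
proof (induction n)
  case (Suc n)
  have "cong_on 2 (sq ((sq ^^ n) x)) (dilate ((sq ^^ n) x))" by (rule cong_on_sq_dilate)
  also have "cong_on 2 \<dots> (dilate ((dilate ^^ n) x))" by (rule cong_on_dilate[OF Suc])
  finally show ?case by simp
qed simp

lemma funpow_sqroot_pow: "g \<in> carrier G \<Longrightarrow> (sqroot ^^ n) (g [^] ((2::nat) ^ n)) = g"
proof (induction n arbitrary: g)
  case (Suc n)
  have "g [^] ((2::nat) ^ Suc n) = g [^] ((2::nat) ^ n) \<otimes> g [^] ((2::nat) ^ n)"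
    using Suc.prems by (simp add: nat_pow_mult mult_2)
  with Suc show ?case by (simp add: funpow_swap1)
qed simp

lemma funpow_dilate: "g \<in> carrier G \<Longrightarrow> (dilate ^^ n) x g = x ((sqroot ^^ n) g)"
proof (induction n arbitrary: g)
  case (Suc n)
  then show ?case by (simp add: dilate_def funpow_swap1)
qed simp

text \<open>Modulo 2, squaring n times evaluates x at 2^n-th roots. By Euler's theorem these are
  trivial when n is a multiple of the totient of |G|. The free \<open>n\<close> allows arbitrarily
  many squarings that still return to x modulo 2.\<close>

lemma frobenius_period: "\<exists>f>0. \<forall>n x. cong_on 2 ((sq ^^ (f * n)) x) x"
proof (intro exI conjI allI)
  let ?f = "totient (order G)"
  have "order G > 0" by (simp add: order_gt_0_iff_finite)
  then show "?f > 0" by simp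
  fix n x
  have "[2 ^ (?f * n) = 1] (mod order G)"
    using cong_pow[OF euler_theorem[of 2 "order G"], of n] odd_order
    by (simp add: power_mult coprime_left_2_iff_odd)
  then have *: "order G dvd 2 ^ (?f * n) - 1"
    by (meson cong_to_1_nat)
  have "(sqroot ^^ (?f * n)) g = g" if g: "g \<in> carrier G" for g
  proof -
    have "2 ^ (?f * n) = Suc (2 ^ (?f * n) - 1)" by simp
    moreover have "g [^] (2 ^ (?f * n) - 1 :: nat) = \<one>"
      using g * ord_dvd_group_order[OF g] by (metis dvd_trans pow_eq_id)
    ultimately have "g [^] ((2::nat) ^ (?f * n)) = g"
      using g by (metis nat_pow_Suc l_one)
    then show ?thesis using funpow_sqroot_pow[OF g, of "?f * n"] by simp
  qed
  then have "cong_on 2 ((dilate ^^ (?f * n)) x) x"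
    by (simp add: cong_on_def dvd_on_def funpow_dilate)
  then show "cong_on 2 ((sq ^^ (?f * n)) x) x"
    using cong_on_funpow_sq_dilate cong_on_trans by blast
qed

text \<open>Iterated squaring yields the power x^(2^n), a multiple of x, and of x^2 as soon as n >
  1.\<close>

lemma funpow_sq_factor: "n > 0 \<Longrightarrow> \<exists>z. (sq ^^ n) x = x \<star> z"
proof (induction n rule: nat_induct_non_zero)
  case (Suc n)
  then obtain z where "(sq ^^ n) x = x \<star> z" by auto
  then have "(sq ^^ Suc n) x = x \<star> (z \<star> (x \<star> z))" by (simp add: sq_def conv_ac)
  then show ?case by blast
qed (auto simp: sq_def)

lemma funpow_sq_factor2: "n > 1 \<Longrightarrow> \<exists>z. (sq ^^ n) x = x \<star> (x \<star> z)"
proof -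
  assume "n > 1"
  then obtain m where m: "n = Suc m" "m > 0" by (cases n) auto
  then obtain z where "(sq ^^ m) (sq x) = sq x \<star> z" using funpow_sq_factor by blast
  then show ?thesis using m by (auto simp: funpow_swap1 sq_def conv_assoc)
qed

text \<open>The power \<open>w\<close> of \<open>x\<close> below approximates an idempotent. As \<open>x = x w + 2 x'\<close>, the induction
  hypothesis for \<open>x'\<close> handles the second summand; for the first one, the dilate of \<open>w\<close> is
  congruent to \<open>w\<^sup>2\<close>, a multiple of \<open>x\<close>, modulo a high power of two.\<close>

lemma dvd_on_dilate_conv:
  "dvd_on (2 ^ e) (x \<star> y) \<Longrightarrow> dvd_on (2 ^ e) (dilate x \<star> y)"
proof (induction e arbitrary: x)
  case 0
  show ?case by (simp add: dvd_on_def)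
next
  case (Suc e)
  obtain f where f: "f > 0" "\<And>n x. cong_on 2 ((sq ^^ (f * n)) x) x"
    using frobenius_period by blast
  obtain z where z: "(sq ^^ (f * 2)) x = x \<star> (x \<star> z)"
    using funpow_sq_factor2[of "f * 2" x] f(1) by auto
  \<comment> \<open>A multiple of the period, so that w and u agree modulo 2; and at least e + 1, so
    that congruences modulo 2^(M+1) are fine enough below.\<close>
  define M where "M = f * Suc e"
  have "M \<ge> Suc e" using f(1) by (cases f) (simp_all add: M_def)
  define u where "u = x \<star> z"
  define w where "w = (sq ^^ M) u"
  have "cong_on 2 (x \<star> w) (x \<star> u)"
    unfolding w_def M_def by (intro cong_on_conv cong_on_refl f)
  also have "x \<star> u = (sq ^^ (f * 2)) x" by (simp add: u_def z)
  also have "cong_on 2 \<dots> x" by (rule f)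
  finally have xw: "cong_on 2 x (x \<star> w)" by (rule cong_on_sym)
  define x' where "x' g = (x g - (x \<star> w) g) div 2" for g
  have x: "x g = (x \<star> w) g + 2 * x' g" if "g \<in> carrier G" for g
    using xw that by (simp add: cong_on_def dvd_on_def x'_def)
  \<comment> \<open>Both summands on the right are multiples of x y, hence divisible by 2^(e+1);
    halving leaves the hypothesis of the induction for x'.\<close>
  have x'2: "(\<lambda>g. 2 * (x' \<star> y) g) = (\<lambda>g. (x \<star> y) g - (w \<star> (x \<star> y)) g)"
  proof -
    have "(\<lambda>g. 2 * (x' \<star> y) g) = (\<lambda>g. 2 * x' g) \<star> y" by (simp add: conv_linear)
    also have "\<dots> = (\<lambda>g. x g - (x \<star> w) g) \<star> y" by (rule conv_cong) (simp_all add: x)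
    finally show ?thesis by (simp add: conv_linear conv_ac)
  qed
  have "dvd_on (2 ^ Suc e) (\<lambda>g. 2 * (x' \<star> y) g)"
    unfolding x'2 by (intro dvd_on_diff dvd_on_conv_right Suc.prems)
  then have "dvd_on (2 ^ e) (x' \<star> y)" by (simp add: dvd_on_def)
  then have IH: "dvd_on (2 ^ e) (dilate x' \<star> y)" by (rule Suc.IH)
  have "dilate x \<star> y = (\<lambda>g. dilate (x \<star> w) g + 2 * dilate x' g) \<star> y"
    by (rule conv_cong) (simp_all add: dilate_def x)
  also have "\<dots> = (\<lambda>g. (dilate x \<star> (dilate w \<star> y)) g + 2 * (dilate x' \<star> y) g)"
    by (simp add: conv_linear dilate_conv conv_assoc)
  finally have eq: "dilate x \<star> y = (\<lambda>g. (dilate x \<star> (dilate w \<star> y)) g + 2 * (dilate x' \<star> y) g)" .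
  \<comment> \<open>The congruence of \<open>dilate u\<close> and u^2 modulo 2 improves by one power
    of two with each squaring; \<open>dilate\<close> commutes with squaring, so the left side is
    \<open>dilate w\<close>.\<close>
  have "cong_on (2 ^ Suc M) ((sq ^^ M) (dilate u)) ((sq ^^ M) (sq u))"
    by (rule cong_on_funpow_sq_lift[OF cong_on_sym[OF cong_on_sq_dilate]])
  moreover have "(sq ^^ M) (dilate u) = dilate w"
    unfolding w_def by (induction M) (simp_all add: sq_def dilate_conv)
  moreover obtain c where "(sq ^^ M) (sq u) = x \<star> c"
    using funpow_sq_factor[of "Suc M" u] by (auto simp: funpow_swap1 u_def conv_assoc)
  ultimately have "cong_on (2 ^ Suc M) (dilate w \<star> y) (c \<star> (x \<star> y))"
    using cong_on_conv[of "2 ^ Suc M" "dilate w" "x \<star> c" y y] by (simp add: conv_ac)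
  moreover have "(2::int) ^ Suc e dvd 2 ^ Suc M"
    using \<open>M \<ge> Suc e\<close> by (intro le_imp_power_dvd) simp
  ultimately have "cong_on (2 ^ Suc e) (dilate w \<star> y) (c \<star> (x \<star> y))"
    unfolding cong_on_def dvd_on_def by (meson dvd_trans)
  then have "dvd_on (2 ^ Suc e) (dilate w \<star> y)"
    by (rule cong_on_dvd_on) (intro dvd_on_conv_right Suc.prems)
  then have "dvd_on (2 ^ Suc e) (dilate x \<star> (dilate w \<star> y))" by (rule dvd_on_conv_right)
  moreover have "dvd_on (2 ^ Suc e) (\<lambda>g. 2 * (dilate x' \<star> y) g)"
    using IH by (simp add: dvd_on_def)
  ultimately show ?case unfolding eq by (rule dvd_on_add)
qed

text \<open>Modulo 2 the square is a rearrangement of the coefficients of x, so an even square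
  forces an even x. Dividing x by 2 divides the square by 4, and the induction continues.\<close>

lemma dvd_on_of_square:
  "dvd_on ((2 ^ e)\<^sup>2) (x \<star> x) \<Longrightarrow> dvd_on (2 ^ e) x"
proof (induction e arbitrary: x)
  case 0
  show ?case by (simp add: dvd_on_def)
next
  case (Suc e)
  have "dvd_on 2 (sq x)"
    using Suc.prems unfolding dvd_on_def sq_def
    by (metis dvd_power_same dvd_trans dvd_triv_left power2_eq_square power_Suc)
  then have "dvd_on 2 (dilate x)" using cong_on_sq_dilate cong_on_sym cong_on_dvd_on by blast
  then have "dvd_on 2 x" by (simp add: dvd_on_dilate_iff)
  define x' where "x' g = x g div 2" for g
  have x: "x g = 2 * x' g" if "g \<in> carrier G" for g
    using \<open>dvd_on 2 x\<close> that by (simp add: dvd_on_def x'_def)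
  have "x \<star> x = (\<lambda>g. 2 * x' g) \<star> (\<lambda>g. 2 * x' g)" by (rule conv_cong) (simp_all add: x)
  then have "x \<star> x = (\<lambda>g. 4 * (x' \<star> x') g)" by (simp add: conv_linear)
  moreover have "((2::int) ^ Suc e)\<^sup>2 = 4 * (2 ^ e)\<^sup>2" by (simp add: power_mult_distrib)
  ultimately have "dvd_on ((2 ^ e)\<^sup>2) (x' \<star> x')"
    using Suc.prems by (simp add: dvd_on_def)
  then have "dvd_on (2 ^ e) x'" by (rule Suc.IH)
  then show ?case by (simp add: dvd_on_def x)
qed

end

subsection \<open>The multiplier two\<close>

context finite_comm_group
begin

abbreviation ind :: "'a set \<Rightarrow> 'a \<Rightarrow> int" where
  "ind A g \<equiv> of_bool (g \<in> A)"

lemma sum_ind: "A \<subseteq> carrier G \<Longrightarrow> sum (ind A) (carrier G) = int (card A)"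
  by (simp add: Int_absorb1)

lemma sum_conv: "(\<Sum>g\<in>carrier G. (x \<star> y) g) = sum x (carrier G) * sum y (carrier G)"
proof -
  have "(\<Sum>g\<in>carrier G. (x \<star> y) g) = (\<Sum>g\<in>carrier G. \<Sum>h\<in>carrier G. x h * y (inv h \<otimes> g))"
    by (simp add: conv_apply)
  also have "\<dots> = (\<Sum>h\<in>carrier G. \<Sum>g\<in>carrier G. x h * y (inv h \<otimes> g))"
    by (rule sum.swap)
  also have "\<dots> = (\<Sum>h\<in>carrier G. \<Sum>g\<in>carrier G. x h * y g)"
  proof (rule sum.cong[OF refl])
    fix h assume h: "h \<in> carrier G"
    show "(\<Sum>g\<in>carrier G. x h * y (inv h \<otimes> g)) = (\<Sum>g\<in>carrier G. x h * y g)"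
      by (rule sum.reindex_bij_witness[where i = "\<lambda>g. h \<otimes> g" and j = "\<lambda>g. inv h \<otimes> g"])
        (use h in auto)
  qed
  also have "\<dots> = sum x (carrier G) * sum y (carrier G)"
    by (simp add: sum_product)
  finally show ?thesis .
qed

lemma conv_const: "g \<in> carrier G \<Longrightarrow> (x \<star> (\<lambda>_. c)) g = c * sum x (carrier G)"
  by (simp add: conv_apply sum_distrib_left mult.commute)

lemma conv_const_left: "g \<in> carrier G \<Longrightarrow> ((\<lambda>_. c) \<star> x) g = c * sum x (carrier G)"
  by (simp add: conv_comm[of "\<lambda>_. c"] conv_const)

abbreviation delta :: "'a \<Rightarrow> 'a \<Rightarrow> int" where
  "delta a g \<equiv> of_bool (g = a)"

lemma conv_delta:
  assumes "a \<in> carrier G" "g \<in> carrier G"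
  shows "(delta a \<star> x) g = x (inv a \<otimes> g)"
  using assms by (simp add: conv_apply sum.remove[of _ a])

end

locale odd_diff_set = odd_comm_group +
  fixes D :: "'a set" and k lam :: nat
  assumes diff_set: "difference_set G D (order G) k lam"
begin

lemma D_subset: "D \<subseteq> carrier G" and card_D: "card D = k"
  using diff_set by (auto simp: difference_set_def)

lemma D_closed: "d \<in> D \<Longrightarrow> d \<in> carrier G"
  using D_subset by auto

lemma finite_D: "finite D"
  by (rule finite_subset[OF D_subset finite_carrier])

lemma card_quotients:
  assumes "g \<in> carrier G"
  shows "card {(d1, d2). d1 \<in> D \<and> d2 \<in> D \<and> d1 \<otimes> inv d2 = g} = (if g = \<one> then k else lam)"
proof (cases "g = \<one>")
  case True
  have "{(d1, d2). d1 \<in> D \<and> d2 \<in> D \<and> d1 \<otimes> inv d2 = \<one>} = (\<lambda>d. (d, d)) ` D"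
    by (auto simp: image_iff D_closed) (metis D_closed inv_closed inv_equality inv_inv)
  then show ?thesis using True by (simp add: card_image inj_on_def card_D)
qed (use assms diff_set in \<open>auto simp: difference_set_def\<close>)

text \<open>The group ring element D^(-1).\<close>

abbreviation "dinv \<equiv> \<lambda>g. ind D (inv g)"

lemma sum_dinv: "sum dinv (carrier G) = int k"
proof -
  have "sum dinv (carrier G) = sum (ind D) (carrier G)"
    by (rule sum.reindex_bij_witness[where i = "m_inv G" and j = "m_inv G"]) auto
  then show ?thesis by (simp add: sum_ind D_subset card_D del: sum_of_bool_eq)
qed

text \<open>The term for h in the product is 1 exactly when h = d1 and g = d1 d2^(-1) with d1, d2 in
  D, so the coefficient counts representations of g as a quotient.\<close>

lemma conv_dinv:
  assumes g: "g \<in> carrier G"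
  shows "(ind D \<star> dinv) g = (int k - int lam) * delta \<one> g + int lam"
proof -
  have "(ind D \<star> dinv) g = (\<Sum>h\<in>carrier G. of_bool (h \<in> D \<and> inv (inv h \<otimes> g) \<in> D))"
    using g by (simp add: conv_apply of_bool_conj)
  also have "\<dots> = int (card {h \<in> carrier G. h \<in> D \<and> inv (inv h \<otimes> g) \<in> D})"
    by (simp add: Int_def)
  also have "card {h \<in> carrier G. h \<in> D \<and> inv (inv h \<otimes> g) \<in> D}
      = card {(d1, d2). d1 \<in> D \<and> d2 \<in> D \<and> d1 \<otimes> inv d2 = g}"
  proof (rule bij_betw_same_card[of "\<lambda>h. (h, inv (inv h \<otimes> g))"], rule bij_betwI[where g = fst])
    show "(\<lambda>h. (h, inv (inv h \<otimes> g))) \<in> {h \<in> carrier G. h \<in> D \<and> inv (inv h \<otimes> g) \<in> D}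
        \<rightarrow> {(d1, d2). d1 \<in> D \<and> d2 \<in> D \<and> d1 \<otimes> inv d2 = g}"
      using g by auto
    have eq: "inv (inv a \<otimes> (a \<otimes> inv b)) = b" if "a \<in> D" "b \<in> D" for a b
      using that D_closed by simp
    show "fst \<in> {(d1, d2). d1 \<in> D \<and> d2 \<in> D \<and> d1 \<otimes> inv d2 = g}
        \<rightarrow> {h \<in> carrier G. h \<in> D \<and> inv (inv h \<otimes> g) \<in> D}"
      using D_closed eq by auto
    show "(fst p, inv (inv (fst p) \<otimes> g)) = p"
      if "p \<in> {(d1, d2). d1 \<in> D \<and> d2 \<in> D \<and> d1 \<otimes> inv d2 = g}" for p
      using that eq by auto
  qed simp
  finally show ?thesis using card_quotients[OF g] by simp
qed

text \<open>Sum of all coefficients on both sides of \<open>conv_dinv\<close>.\<close>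

lemma k_square: "(int k)\<^sup>2 = (int k - int lam) + int lam * int (order G)"
proof -
  have "(int k)\<^sup>2 = (\<Sum>g\<in>carrier G. (ind D \<star> dinv) g)"
    by (simp add: sum_conv sum_dinv sum_ind D_subset card_D power2_eq_square del: sum_of_bool_eq)
  also have "\<dots> = (int k - int lam) * sum (delta \<one>) (carrier G) + int lam * int (order G)"
    by (simp add: conv_dinv sum.distrib sum_distrib_left order_def del: sum_of_bool_eq)
  finally show ?thesis by (simp add: of_bool_def)
qed

text \<open>The conclusion says D^(2) = a D. Nonnegativity and the coefficient sum pin down E =
  D^(2) D^(-1) as lambda G + (k - lambda) a; multiplying by D then removes the factor
  D^(-1).\<close>

lemma square_translate:
  assumes e: "k = lam + 2 ^ e" "lam < 2 ^ e"
  shows "\<exists>a\<in>carrier G. \<forall>d\<in>carrier G. inv a \<otimes> (d \<otimes> d) \<in> D \<longleftrightarrow> d \<in> D"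
proof -
  define N :: int where "N = 2 ^ e"
  define v where "v = int (order G)"
  have N: "int k = int lam + N" "int lam < N"
    using e by (simp_all add: N_def flip: of_nat_less_iff)
  have "coprime N v" using odd_order by (simp add: N_def v_def)
  have sumD: "sum (ind D) (carrier G) = int k"
    by (simp add: sum_ind D_subset card_D del: sum_of_bool_eq)
  have sum_dilate: "sum (dilate (ind D)) (carrier G) = int k"
  proof -
    have "sum (dilate (ind D)) (carrier G) = sum (ind D) (carrier G)"
      by (rule sum.reindex_bij_witness[where i = "\<lambda>g. g \<otimes> g" and j = sqroot]) (auto simp: dilate_def)
    then show ?thesis using sumD by simp
  qed
  \<comment> \<open>D D^(-1) itself is not divisible by N. Subtracting k G makes the coefficient sum
    of y zero, and by \<open>k_square\<close> D y becomes N (v - G).\<close>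
  define y where "y = (\<lambda>g. v * dinv g - int k)"
  have y: "(x \<star> y) g = v * (x \<star> dinv) g - int k * sum x (carrier G)" if "g \<in> carrier G" for x g
    using that by (simp add: y_def conv_linear conv_const)
  have "dvd_on N (ind D \<star> y)"
    using k_square by (auto simp: dvd_on_def y conv_dinv sumD N algebra_simps v_def power2_eq_square
      simp del: sum_of_bool_eq)
  then have dvd: "dvd_on N (dilate (ind D) \<star> y)" unfolding N_def by (rule dvd_on_dilate_conv)
  define E where "E = dilate (ind D) \<star> dinv"
  have dvdE: "N dvd E g - int lam" if "g \<in> carrier G" for g
  proof -
    have "N dvd v * E g - (int k)\<^sup>2"
      using dvd that by (simp add: dvd_on_def y E_def sum_dilate power2_eq_square)
    then have "N dvd v * E g - (int k)\<^sup>2 + N" by simp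
    also have "v * E g - (int k)\<^sup>2 + N = v * (E g - int lam)"
      using k_square N by (simp add: v_def algebra_simps)
    finally show ?thesis using \<open>coprime N v\<close> by (simp add: coprime_dvd_mult_right_iff)
  qed
  define F where "F g = (E g - int lam) div N" for g
  have E: "E g = int lam + N * F g" if "g \<in> carrier G" for g
    using dvdE[OF that] by (simp add: F_def)
  \<comment> \<open>As E \<ge> 0 and lambda < N, the multiple N (F + 1) = E - lambda + N is
    positive.\<close>
  have F_nonneg: "F g \<ge> 0" if "g \<in> carrier G" for g
  proof -
    have "E g \<ge> 0" using that by (auto simp: E_def conv_apply dilate_def intro!: sum_nonneg)
    then have "0 < N * (F g + 1)" using E[OF that] N by (simp add: algebra_simps)
    then show ?thesis using N by (simp add: zero_less_mult_iff)
  qed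
  have "(int k)\<^sup>2 = sum E (carrier G)"
    by (simp add: E_def sum_conv sum_dilate sum_dinv power2_eq_square del: sum_of_bool_eq)
  also have "\<dots> = int lam * v + N * sum F (carrier G)"
    by (simp add: E sum.distrib sum_distrib_left v_def order_def)
  \<comment> \<open>Comparison with k^2 = N + lambda v. Nonnegative integers with sum 1 are
    concentrated in a single point a.\<close>
  finally have sumF: "sum F (carrier G) = 1"
    using k_square N by (simp add: v_def)
  then obtain a where a: "a \<in> carrier G" "F a \<noteq> 0"
    by (metis sum.neutral zero_neq_one)
  have "sum F (carrier G) = F a + sum F (carrier G - {a})"
    using a by (simp add: sum.remove)
  moreover have "sum F (carrier G - {a}) \<ge> 0" using F_nonneg by (intro sum_nonneg) auto
  ultimately have Fa: "F a = 1" and "sum F (carrier G - {a}) = 0"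
    using sumF F_nonneg[OF a(1)] a(2) by auto
  then have "\<forall>g\<in>carrier G - {a}. F g = 0"
    using F_nonneg by (subst (asm) sum_nonneg_eq_0_iff) auto
  with Fa E have E': "E g = N * delta a g + int lam" if "g \<in> carrier G" for g
    using that by auto
  have "E \<star> ind D = dilate (ind D) \<star> (ind D \<star> dinv)"
    by (simp add: E_def conv_ac)
  also have "\<dots> = dilate (ind D) \<star> (\<lambda>g. N * delta \<one> g + int lam)"
    by (rule conv_cong) (simp_all add: conv_dinv N)
  also have "E \<star> ind D = (\<lambda>g. N * delta a g + int lam) \<star> ind D"
    by (rule conv_cong) (simp_all add: E')
  finally have eq: "((\<lambda>g. N * delta a g + int lam) \<star> ind D) g
      = (dilate (ind D) \<star> (\<lambda>g. N * delta \<one> g + int lam)) g" for g by simp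
  \<comment> \<open>The two constant parts both contribute lambda k; they cancel, and then so does
    N.\<close>
  have key: "ind D (inv a \<otimes> g) = dilate (ind D) g" if g: "g \<in> carrier G" for g
    using eq[of g] g a N
    by (simp add: conv_linear conv_const conv_const_left conv_comm[of _ "delta \<one>"]
      conv_delta sumD sum_dilate del: sum_of_bool_eq)
  show ?thesis
  proof (intro bexI[of _ a] ballI)
    fix d assume d: "d \<in> carrier G"
    show "inv a \<otimes> (d \<otimes> d) \<in> D \<longleftrightarrow> d \<in> D"
      using key[of "d \<otimes> d"] d by (auto simp: dilate_def of_bool_def split: if_splits)
  qed (rule a)
qed

text \<open>The map d to a^(-1) d^2 permutes D. Taking the product over D, which is 1, gives a^(-k)
  = 1; as k is coprime to |G|, a = 1.\<close>

lemma square_mem: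
  assumes e: "k = lam + 2 ^ e" "lam < 2 ^ e" and cop: "coprime k (order G)"
    and norm: "normalized_difference_set G D" and "d \<in> D"
  shows "d \<otimes> d \<in> D"
proof -
  obtain a where a: "a \<in> carrier G" "\<And>d. d \<in> carrier G \<Longrightarrow> inv a \<otimes> (d \<otimes> d) \<in> D \<longleftrightarrow> d \<in> D"
    using square_translate[OF e] by blast
  define \<phi> where "\<phi> d = inv a \<otimes> (d \<otimes> d)" for d
  have inj: "inj_on \<phi> D"
  proof (rule inj_onI)
    fix x y assume xy: "x \<in> D" "y \<in> D" "\<phi> x = \<phi> y"
    then have "x \<otimes> x = y \<otimes> y" using a D_closed by (simp add: \<phi>_def)
    then show "x = y" using xy D_closed square_inj by blast
  qed
  have im: "\<phi> ` D = D"
    by (rule endo_inj_surj[OF finite_D _ inj]) (use a D_closed in \<open>auto simp: \<phi>_def\<close>)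
  have prod: "finprod G (\<lambda>d. d) D = \<one>"
    using norm by (simp add: normalized_difference_set_def)
  have "\<one> = finprod G (\<lambda>d. d) (\<phi> ` D)" by (simp add: im prod)
  also have "\<dots> = finprod G \<phi> D"
    by (subst finprod_reindex) (use inj a D_closed in \<open>auto simp: \<phi>_def o_def Pi_iff\<close>)
  also have "\<dots> = inv a [^] k"
    using a D_closed prod unfolding \<phi>_def
    by (simp add: finprod_multf Pi_iff finprod_const card_D)
  finally have "ord (inv a) dvd k"
    using a pow_eq_id[of "inv a" k] by simp
  moreover have "ord (inv a) dvd order G" using a by (intro ord_dvd_group_order) simp
  ultimately have "ord (inv a) = 1" using cop coprime_common_divisor_nat by blast
  then have "inv a = \<one>" using a ord_eq_1[of "inv a"] by simp
  then show ?thesis using a(2)[of d] \<open>d \<in> D\<close> D_closed by simp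
qed

end

subsection \<open>Coset intersection numbers\<close>

context finite_comm_group
begin

text \<open>Cauchy's theorem inside H: Sylow's existence theorem for the exponent 1 gives a subgroup
  of order p.\<close>

lemma cauchy_subgroup:
  assumes H: "subgroup H G" and p: "Factorial_Ring.prime p" "p dvd card H"
  shows "\<exists>x\<in>H. x \<noteq> \<one> \<and> x [^] p = \<one>"
proof -
  let ?H = "G\<lparr>carrier := H\<rparr>"
  interpret H: group ?H by (rule subgroup.subgroup_is_group[OF H is_group])
  obtain m where "card H = p * m" using p by blast
  moreover have "finite H" using H finite_subset[OF subgroup.subset finite_carrier] by blast
  ultimately obtain K where K: "subgroup K ?H" "card K = p"
    using sylow_thm[of p ?H 1 m] p H.is_group by (auto simp: order_def)
  then have KG: "subgroup K G" using incl_subgroup[OF H] by simp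
  obtain x where x: "x \<in> K" "x \<noteq> \<one>"
    using K(2) prime_gt_1_nat[OF p(1)] card_le_Suc0_iff_eq[of K] subgroup.one_closed[OF KG]
    by (metis One_nat_def card.infinite le_zero_eq linorder_not_le not_less_eq_eq nat_le_linear)
  interpret K: group "G\<lparr>carrier := K\<rparr>" by (rule subgroup.subgroup_is_group[OF KG is_group])
  have "x [^] p = \<one>"
    using K.pow_order_eq_1[of x] x K(2) by (simp add: order_def flip: nat_pow_consistent)
  moreover have "x \<in> H" using x subgroup.subset[OF K(1)] by auto
  ultimately show ?thesis using x by blast
qed

lemma subgroup_pow: "subgroup H G \<Longrightarrow> x \<in> H \<Longrightarrow> x [^] (n::nat) \<in> H"
  by (induction n) (auto intro: subgroup.one_closed subgroup.m_closed)

definition torsion :: "nat \<Rightarrow> 'a set" where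
  "torsion n = {x \<in> carrier G. x [^] n = \<one>}"

lemma subgroup_torsion: "subgroup (torsion n) G"
  by (rule subgroupI) (auto simp: torsion_def nat_pow_inv pow_mult_distrib m_comm)

text \<open>A common prime p would give, by Cauchy, a nontrivial element whose order divides both a
  and p, hence both a and b.\<close>

lemma coprime_card_torsion:
  assumes "coprime a b" shows "coprime (card (torsion a)) b"
proof (rule ccontr)
  assume "\<not> ?thesis"
  then obtain p where p: "Factorial_Ring.prime p" "p dvd gcd (card (torsion a)) b"
    by (metis coprime_iff_gcd_eq_1 prime_factor_nat)
  then obtain x where x: "x \<in> torsion a" "x \<noteq> \<one>" "x [^] p = \<one>"
    using cauchy_subgroup[OF subgroup_torsion, of p a] by auto
  then have "ord x dvd a" "ord x dvd p" by (auto simp: torsion_def pow_eq_id)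
  then have "ord x dvd gcd a b" using p by (meson dvd_trans gcd_greatest gcd_dvd2)
  then have "ord x = 1" using assms by simp
  then show False using x ord_eq_1[of x] by (auto simp: torsion_def)
qed

text \<open>Multiplication is a bijection from the product of the two torsion parts onto G, so their
  cardinalities multiply to a b. By coprimality each divides its own factor, which forces
  equality.\<close>

lemma card_torsion:
  assumes ord: "order G = a * b" and cop: "coprime a b"
  shows "card (torsion a) = a"
proof -
  have pos: "order G > 0" by (simp add: order_gt_0_iff_finite)
  let ?f = "\<lambda>(x, y). x \<otimes> y"
  have inj: "inj_on ?f (torsion a \<times> torsion b)"
  proof (rule inj_onI, clarify)
    fix x y x' y'
    assume *: "x \<in> torsion a" "y \<in> torsion b" "x' \<in> torsion a" "y' \<in> torsion b"
      and eq: "x \<otimes> y = x' \<otimes> y'"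
    then have c: "x \<in> carrier G" "y \<in> carrier G" "x' \<in> carrier G" "y' \<in> carrier G"
      by (auto simp: torsion_def)
    define z where "z = x \<otimes> inv x'"
    have z: "z = inv y \<otimes> y'"
    proof -
      have "z = inv y \<otimes> inv x' \<otimes> (x \<otimes> y)" using c by (simp add: z_def m_ac)
      also have "\<dots> = inv y \<otimes> y'" unfolding eq using c by (simp add: m_assoc)
      finally show ?thesis .
    qed
    have "z \<in> torsion a" unfolding z_def
      using * by (intro subgroup.m_closed[OF subgroup_torsion] subgroup.m_inv_closed[OF subgroup_torsion])
    moreover have "z \<in> torsion b" unfolding z
      using * by (intro subgroup.m_closed[OF subgroup_torsion] subgroup.m_inv_closed[OF subgroup_torsion])
    ultimately have "ord z dvd a" "ord z dvd b" "z \<in> carrier G"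
      by (auto simp: torsion_def pow_eq_id)
    then have "z = \<one>" using cop ord_eq_1[of z] coprime_common_divisor_nat by blast
    then show "x = x' \<and> y = y'" using c z z_def
      by (metis inv_equality inv_inv inv_mult_cancel(2) inv_closed r_one)
  qed
  have "carrier G \<subseteq> ?f ` (torsion a \<times> torsion b)"
  proof
    fix g assume g: "g \<in> carrier G"
    have kill: "g [^] (a * b * n) = \<one>" for n
      using g ord pow_order_eq_1[OF g] by (simp flip: nat_pow_pow)
    obtain u w where uw: "a * u = b * w + 1"
      using cop pos ord bezout_nat[of a b] by auto
    have "g [^] (b * w) \<in> torsion a" "g [^] (a * u) \<in> torsion b"
      using g kill[of w] kill[of u] by (auto simp: torsion_def nat_pow_pow ac_simps)
    moreover have "g = inv (g [^] (b * w)) \<otimes> g [^] (a * u)"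
      using g unfolding uw by simp
    ultimately show "g \<in> ?f ` (torsion a \<times> torsion b)"
      by (intro image_eqI[where x = "(inv (g [^] (b * w)), g [^] (a * u))"])
        (auto intro: subgroup.m_inv_closed[OF subgroup_torsion])
  qed
  then have "?f ` (torsion a \<times> torsion b) = carrier G"
    by (auto simp: torsion_def)
  then have prod: "card (torsion a) * card (torsion b) = a * b"
    using card_image[OF inj] ord by (simp add: order_def card_cartesian_product)
  have pos_ab: "a > 0" "b > 0" using pos ord by auto
  have "card (torsion a) dvd a"
    using coprime_card_torsion[OF cop] prod by (metis coprime_dvd_mult_left_iff dvd_triv_left)
  moreover have "card (torsion b) dvd b"
    using coprime_card_torsion[of b a] cop prod
    by (metis coprime_commute coprime_dvd_mult_right_iff dvd_triv_right)
  ultimately have "card (torsion a) \<le> a" "card (torsion b) \<le> b"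
    using pos_ab by (auto intro: dvd_imp_le)
  moreover from this have "a * b \<le> card (torsion a) * b"
    using prod mult_le_mono2[of "card (torsion b)" b "card (torsion a)"] by simp
  ultimately show ?thesis using pos_ab by simp
qed

end

section \<open>Intersection numbers under a multiplier acting as inversion\<close>

context odd_diff_set
begin

text \<open>For a subgroup H this is the size of the intersection of D with the coset g H, written
  so that it is the coefficient of D H at g. As a function on G it counts every coset |H|
  times.\<close>

definition meet :: "'a set \<Rightarrow> 'a \<Rightarrow> nat" where
  "meet H g = card {d \<in> D. inv d \<otimes> g \<in> H}"

lemma conv_ind_meet:
  assumes "g \<in> carrier G" shows "(ind D \<star> ind H) g = int (meet H g)"
proof -
  have "(ind D \<star> ind H) g = (\<Sum>h\<in>carrier G. of_bool (h \<in> D \<and> inv h \<otimes> g \<in> H))"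
    using assms by (simp add: conv_apply of_bool_conj)
  also have "{h \<in> carrier G. h \<in> D \<and> inv h \<otimes> g \<in> H} = {d \<in> D. inv d \<otimes> g \<in> H}"
    using D_closed by auto
  then have "(\<Sum>h\<in>carrier G. of_bool (h \<in> D \<and> inv h \<otimes> g \<in> H)) = int (meet H g)"
    by (simp add: Int_def meet_def)
  finally show ?thesis .
qed

lemma sum_meet:
  assumes "H \<subseteq> carrier G" shows "(\<Sum>g\<in>carrier G. meet H g) = k * card H"
proof -
  have "int (\<Sum>g\<in>carrier G. meet H g) = (\<Sum>g\<in>carrier G. (ind D \<star> ind H) g)"
    by (simp add: conv_ind_meet)
  also have "\<dots> = int k * int (card H)"
    by (simp add: sum_conv sum_ind assms D_subset card_D del: sum_of_bool_eq)
  finally show ?thesis by (simp only: of_nat_mult [symmetric] of_nat_eq_iff)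
qed

lemma conv_dinv_meet:
  assumes H: "subgroup H G" and g: "g \<in> carrier G"
  shows "(dinv \<star> ind H) g = int (meet H (inv g))"
proof -
  have HI: "inv x \<in> H \<longleftrightarrow> x \<in> H" if "x \<in> carrier G" for x
    using H that by (metis inv_inv subgroup.m_inv_closed)
  have "(dinv \<star> ind H) g = (\<Sum>h\<in>carrier G. dinv h * ind H (inv h \<otimes> g))"
    using g by (simp add: conv_apply)
  also have "\<dots> = (\<Sum>h\<in>carrier G. ind D h * ind H (inv h \<otimes> inv g))"
  proof (rule sum.reindex_bij_witness[where i = "m_inv G" and j = "m_inv G"])
    fix h assume h: "h \<in> carrier G"
    show "ind D (inv h) * ind H (inv (inv h) \<otimes> inv g) = dinv h * ind H (inv h \<otimes> g)"
      using h g HI[of "inv h \<otimes> g"] by (simp add: inv_mult)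
  qed auto
  finally show ?thesis using conv_ind_meet[of "inv g" H] g by (simp add: conv_apply)
qed

lemma pow2_mem:
  assumes "\<And>d. d \<in> D \<Longrightarrow> d \<otimes> d \<in> D" "d \<in> D"
  shows "d [^] ((2::nat) ^ j) \<in> D"
proof (induction j)
  case (Suc j)
  have "d [^] ((2::nat) ^ Suc j) = d [^] ((2::nat) ^ j) \<otimes> d [^] ((2::nat) ^ j)"
    using assms D_closed by (simp add: nat_pow_mult mult_2)
  then show ?case using Suc assms by simp
qed (use assms D_closed in simp)

text \<open>If \<open>g\<^sup>t\<^sup>+\<^sup>1 \<in> H\<close> for all \<open>g\<close>, the multiplier \<open>t\<close> acts on the cosets of \<open>H\<close> as inversion.\<close>

lemma meet_inv_le:
  assumes sq_closed: "\<And>d. d \<in> D \<Longrightarrow> d \<otimes> d \<in> D" and H: "subgroup H G"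
    and pow: "\<And>g. g \<in> carrier G \<Longrightarrow> g [^] ((2::nat) ^ j + 1) \<in> H" and g: "g \<in> carrier G"
  shows "meet H g \<le> meet H (inv g)"
  unfolding meet_def
proof (rule card_inj_on_le)
  let ?t = "(2::nat) ^ j"
  show "inj_on (\<lambda>d. d [^] ?t) {d \<in> D. inv d \<otimes> g \<in> H}"
    by (rule inj_onI) (metis (no_types, lifting) D_closed funpow_sqroot_pow mem_Collect_eq)
  show "(\<lambda>d. d [^] ?t) ` {d \<in> D. inv d \<otimes> g \<in> H} \<subseteq> {d \<in> D. inv d \<otimes> inv g \<in> H}"
  proof clarify
    fix d assume d: "d \<in> D" "inv d \<otimes> g \<in> H"
    have c: "d \<in> carrier G" using d D_closed by simp
    \<comment> \<open>Dividing by g^(t+1), an element of H, turns g^t into g^(-1); so d^t lies in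
      the coset of g^(-1).\<close>
    have "(inv d \<otimes> g) [^] ?t \<otimes> inv (g [^] (?t + 1)) \<in> H"
      by (rule subgroup.m_closed[OF H subgroup_pow[OF H d(2)] subgroup.m_inv_closed[OF H pow[OF g]]])
    also have "(inv d \<otimes> g) [^] ?t = inv (d [^] ?t) \<otimes> g [^] ?t"
      using c g by (simp add: pow_mult_distrib m_comm nat_pow_inv)
    also have "inv (g [^] (?t + 1)) = inv (g [^] ?t) \<otimes> inv g"
      using g by (simp add: inv_mult)
    also have "inv (d [^] ?t) \<otimes> g [^] ?t \<otimes> (inv (g [^] ?t) \<otimes> inv g) = inv (d [^] ?t) \<otimes> inv g"
      using c g by (simp add: m_assoc)
    finally show "d [^] ?t \<in> D \<and> inv (d [^] ?t) \<otimes> inv g \<in> H"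
      using pow2_mem[OF sq_closed d(1)] by simp
  qed
qed (simp add: finite_D)

context
  fixes m j :: nat and H :: "'a set"
  assumes k_lam: "k = lam + (2 ^ m)\<^sup>2"
    and sq_closed: "\<And>d. d \<in> D \<Longrightarrow> d \<otimes> d \<in> D"
    and H: "subgroup H G"
    and pow: "\<And>g. g \<in> carrier G \<Longrightarrow> g [^] ((2::nat) ^ j + 1) \<in> H"
begin

lemma meet_inv:
  assumes "g \<in> carrier G" shows "meet H (inv g) = meet H g"
proof -
  have "meet H g \<le> meet H (inv g)" using meet_inv_le sq_closed H pow assms by blast
  moreover have "meet H (inv g) \<le> meet H (inv (inv g))"
    using meet_inv_le sq_closed H pow assms by blast
  ultimately show ?thesis using assms by simp
qed

text \<open>Invariance under inversion means D H = D^(-1) H, so (D H)^2 = (D D^(-1)) H^2 with H^2 =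
  |H| H. The result is a true square, as \<open>dvd_on_of_square\<close> demands.\<close>

lemma conv_meet_meet:
  assumes g: "g \<in> carrier G"
  shows "((ind D \<star> ind H) \<star> (ind D \<star> ind H)) g
    = int (card H) * ((2 ^ m)\<^sup>2 * ind H g + int lam * int (card H))"
proof -
  have Hsub: "H \<subseteq> carrier G" by (rule subgroup.subset[OF H])
  have HH: "(ind H \<star> ind H) g = int (card H) * ind H g" if g: "g \<in> carrier G" for g
  proof -
    have "ind H h * ind H (inv h \<otimes> g) = ind H h * ind H g" if h: "h \<in> carrier G" for h
    proof (cases "h \<in> H")
      case True
      then have "inv h \<otimes> g \<in> H \<longleftrightarrow> g \<in> H"
        using g h by (metis H inv_mult_cancel(2) subgroup.m_closed subgroup.m_inv_closed)
      then show ?thesis by simp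
    qed simp
    then have "(ind H \<star> ind H) g = (\<Sum>h\<in>carrier G. ind H h * ind H g)"
      using g by (simp add: conv_apply del: of_bool_conj)
    also have "\<dots> = sum (ind H) (carrier G) * ind H g"
      by (simp add: sum_distrib_right del: sum_of_bool_eq)
    finally show ?thesis by (simp add: sum_ind Hsub del: sum_of_bool_eq)
  qed
  have "ind D \<star> ind H \<star> (ind D \<star> ind H) = ind D \<star> ind H \<star> (dinv \<star> ind H)"
    by (rule conv_cong) (simp_all add: conv_ind_meet conv_dinv_meet H meet_inv)
  also have "\<dots> = (ind D \<star> dinv) \<star> (ind H \<star> ind H)" by (simp add: conv_ac)
  also have "\<dots> = (\<lambda>g. (2 ^ m)\<^sup>2 * delta \<one> g + int lam) \<star> (\<lambda>g. int (card H) * ind H g)"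
    by (rule conv_cong) (simp_all add: conv_dinv HH k_lam)
  finally have "((ind D \<star> ind H) \<star> (ind D \<star> ind H)) g
      = (2 ^ m)\<^sup>2 * (int (card H) * (delta \<one> \<star> ind H) g) + int (card H) * ((\<lambda>_. int lam) \<star> ind H) g"
    by (simp only: conv_linear)
  then show ?thesis using g
    by (simp add: conv_delta conv_const_left sum_ind Hsub algebra_simps del: sum_of_bool_eq)
qed

text \<open>The coefficient of (D H)^2 at the identity; by \<open>meet_inv\<close> its terms are
  squares.\<close>

lemma sum_meet_square:
  "(\<Sum>g\<in>carrier G. (meet H g)\<^sup>2) = card H * ((2 ^ m)\<^sup>2 + lam * card H)"
proof -
  have "int (\<Sum>g\<in>carrier G. (meet H g)\<^sup>2) = ((ind D \<star> ind H) \<star> (ind D \<star> ind H)) \<one>"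
    by (simp add: conv_apply[of \<one>] conv_ind_meet meet_inv power2_eq_square)
  also have "\<dots> = int (card H * ((2 ^ m)\<^sup>2 + lam * card H))"
    using subgroup.one_closed[OF H] by (simp add: conv_meet_meet)
  finally show ?thesis by linarith
qed

lemma dvd_meet:
  assumes g: "g \<in> carrier G"
  shows "2 ^ m dvd int (order G) * int (meet H g) - int k * int (card H)"
proof -
  define c where "c = ind D \<star> ind H"
  define v where "v = int (order G)"
  define K where "K = int k * int (card H)"
  have sumc: "sum c (carrier G) = K"
    unfolding c_def K_def
    by (simp add: sum_conv sum_ind D_subset card_D subgroup.subset[OF H] del: sum_of_bool_eq)
  \<comment> \<open>Normalized to coefficient sum zero: x^2 = v^2 (D H)^2 - v K^2 G, where the terms
    with lambda cancel and the factor (2^m)^2 is left.\<close>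
  define x where "x = (\<lambda>g. v * c g - K)"
  have K2: "K\<^sup>2 = ((2 ^ m)\<^sup>2 + int lam * v) * (int (card H))\<^sup>2"
    using k_square by (simp add: K_def v_def power_mult_distrib k_lam)
  have "(x \<star> x) h = (2 ^ m)\<^sup>2 * (v\<^sup>2 * int (card H) * ind H h - v * (int (card H))\<^sup>2)"
    if h: "h \<in> carrier G" for h
  proof -
    have "(x \<star> x) h = v * (v * (c \<star> c) h) - v * (c \<star> (\<lambda>_. K)) h
        - (v * ((\<lambda>_. K) \<star> c) h - ((\<lambda>_. K) \<star> (\<lambda>_. K)) h)"
      unfolding x_def by (simp only: conv_linear) (simp add: algebra_simps)
    also have "\<dots> = v\<^sup>2 * (c \<star> c) h - v * K\<^sup>2"
      using h by (simp add: conv_const conv_const_left sumc order_def v_def power2_eq_square algebra_simps)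
    also have "(c \<star> c) h = int (card H) * ((2 ^ m)\<^sup>2 * ind H h + int lam * int (card H))"
      using h by (simp add: c_def conv_meet_meet)
    finally show ?thesis unfolding K2 by (simp add: algebra_simps power2_eq_square)
  qed
  then have "dvd_on ((2 ^ m)\<^sup>2) (x \<star> x)" by (simp add: dvd_on_def)
  then have "dvd_on (2 ^ m) x" by (rule dvd_on_of_square)
  then show ?thesis using g by (simp add: dvd_on_def x_def c_def conv_ind_meet v_def K_def)
qed

end

end

section \<open>The (15,7,3)-difference set in a cyclic group of order 15\<close>

context finite_comm_group
begin

text \<open>M consists of the powers of x, and exponents carry the question to the set
  \<open>I\<close> in the integers modulo 15.\<close>

lemma difference_set_15_7_3:
  assumes x: "x \<in> carrier G" "ord x = 15"
    and D: "\<And>i. i < 15 \<Longrightarrow> x [^] i \<in> D \<longleftrightarrow> i \<in> {0, 1, 2, 4, 5, 8, 10 :: nat}"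
  shows "\<exists>M. subgroup M G \<and> card M = 15 \<and> difference_set (G\<lparr>carrier := M\<rparr>) (D \<inter> M) 15 7 3"
proof -
  define I :: "nat set" where "I = {0, 1, 2, 4, 5, 8, 10}"
  define M where "M = (\<lambda>i. x [^] i) ` {..<15::nat}"
  have inj: "inj_on (\<lambda>i. x [^] i) {..<15::nat}"
  proof -
    have "{0..ord x - 1} = {..<15::nat}" using x by auto
    then show ?thesis using ord_inj[OF x(1)] by simp
  qed
  have "{x [^] i |i. i \<in> {0..ord x - 1}} = M"
    using x(2) by (auto simp: M_def image_iff)
  then have M: "subgroup M G"
    using element_generates_subgroup[OF finite_carrier x(1)] by simp
  have card_M: "card M = 15"
    using card_image[OF inj] by (simp add: M_def)
  have I: "I \<subseteq> {..<15}" by (auto simp: I_def)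
  have DM: "D \<inter> M = (\<lambda>i. x [^] i) ` I"
    using D I unfolding M_def I_def by blast
  have card_DM: "card (D \<inter> M) = 7"
    unfolding DM using card_image[OF inj_on_subset[OF inj I]] by (simp add: I_def)
  have pow_mod: "x [^] n = x [^] (n mod 15)" for n :: nat
  proof -
    have "x [^] n = x [^] (15 * (n div 15)) \<otimes> x [^] (n mod 15)"
      using x by (simp add: nat_pow_mult)
    moreover have "x [^] (15 * (n div 15)) = \<one>" using x by (simp add: pow_eq_id)
    ultimately show ?thesis using x by simp
  qed
  have count: "card {(d1, d2). d1 \<in> D \<inter> M \<and> d2 \<in> D \<inter> M \<and> d1 \<otimes> inv d2 = g} = 3"
    if g: "g \<in> M - {\<one>}" for g
  proof -
    obtain c :: nat where c: "c < 15" "g = x [^] c"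
      using g by (auto simp: M_def)
    with g have "c \<noteq> 0" by (metis Diff_iff insertI1 nat_pow_0)
    have quot: "x [^] i \<otimes> inv (x [^] j) = g \<longleftrightarrow> i = (c + j) mod 15" if "i < 15" for i j
    proof -
      have "x [^] i \<otimes> inv (x [^] j) = g \<longleftrightarrow> x [^] i = x [^] ((c + j) mod 15)"
      proof -
        have "x [^] i \<otimes> inv (x [^] j) = g \<longleftrightarrow> x [^] i = x [^] c \<otimes> x [^] j"
          using x c inv_solve_right'[of g "x [^] i" "x [^] j"] by auto
        also have "x [^] c \<otimes> x [^] j = x [^] ((c + j) mod 15)"
          using x pow_mod[of "c + j"] by (simp add: nat_pow_mult)
        finally show ?thesis .
      qed
      also have "\<dots> \<longleftrightarrow> i = (c + j) mod 15"
        using inj_on_eq_iff[OF inj, of i "(c + j) mod 15"] that by simp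
      finally show ?thesis .
    qed
    let ?P = "Set.filter (\<lambda>(i, j). i = (c + j) mod 15) (I \<times> I)"
    have "{(d1, d2). d1 \<in> D \<inter> M \<and> d2 \<in> D \<inter> M \<and> d1 \<otimes> inv d2 = g}
        = (\<lambda>(i, j). (x [^] i, x [^] j)) ` ?P" (is "?L = ?R")
    proof
      show "?L \<subseteq> ?R"
      proof clarify
        fix d1 d2 assume "d1 \<in> D" "d1 \<in> M" "d2 \<in> D" "d2 \<in> M" and g: "g = d1 \<otimes> inv d2"
        then obtain i j where ij: "i \<in> I" "j \<in> I" "d1 = x [^] i" "d2 = x [^] j"
          using DM by blast
        then have "i = (c + j) mod 15" using quot[of i j] g I by auto
        then show "(d1, d2) \<in> ?R" using ij by (intro image_eqI[where x = "(i, j)"]) auto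
      qed
      show "?R \<subseteq> ?L"
      proof clarify
        fix i j assume ij: "(i, j) \<in> ?P"
        then have "i \<in> I" "j \<in> I" "i = (c + j) mod 15" by auto
        then show "x [^] i \<in> D \<inter> M \<and> x [^] j \<in> D \<inter> M \<and> x [^] i \<otimes> inv (x [^] j) = g"
          using quot[of i j] I unfolding DM by auto
      qed
    qed
    moreover have "inj_on (\<lambda>(i, j). (x [^] i, x [^] j)) ?P"
      using inj I by (auto simp: inj_on_def)
    ultimately have "card {(d1, d2). d1 \<in> D \<inter> M \<and> d2 \<in> D \<inter> M \<and> d1 \<otimes> inv d2 = g} = card ?P"
      by (simp add: card_image)
    \<comment> \<open>Stated for all nonzero shifts at once, the count is a closed finite statement
      and can be evaluated.\<close>
    also have "\<forall>c\<in>{1..<15::nat}. card (Set.filter (\<lambda>(i, j). i = (c + j) mod 15) (I \<times> I)) = 3"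
      unfolding I_def by code_simp
    then have "card ?P = 3" using c \<open>c \<noteq> 0\<close> by simp
    finally show ?thesis .
  qed
  have "difference_set (G\<lparr>carrier := M\<rparr>) (D \<inter> M) 15 7 3"
    unfolding difference_set_def
  proof (intro conjI ballI)
    show "comm_group (G\<lparr>carrier := M\<rparr>)" 
      by (rule group.group_comm_groupI[OF subgroup_imp_group[OF M]])
        (auto intro!: m_comm subgroup.mem_carrier[OF M])
    show "finite (carrier (G\<lparr>carrier := M\<rparr>))" by (simp add: M_def)
    show "card (carrier (G\<lparr>carrier := M\<rparr>)) = 15" by (simp add: card_M)
    show "D \<inter> M \<subseteq> carrier (G\<lparr>carrier := M\<rparr>)" by simp
    show "card (D \<inter> M) = 7" by (rule card_DM)
    fix g assume g: "g \<in> carrier (G\<lparr>carrier := M\<rparr>) - {\<one>\<^bsub>G\<lparr>carrier := M\<rparr>\<^esub>}"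
    have "{(d1, d2). d1 \<in> D \<inter> M \<and> d2 \<in> D \<inter> M \<and>
          d1 \<otimes>\<^bsub>G\<lparr>carrier := M\<rparr>\<^esub> inv\<^bsub>G\<lparr>carrier := M\<rparr>\<^esub> d2 = g}
        = {(d1, d2). d1 \<in> D \<inter> M \<and> d2 \<in> D \<inter> M \<and> d1 \<otimes> inv d2 = g}"
      using m_inv_consistent[OF M] by auto
    then show "card {(d1, d2). d1 \<in> D \<inter> M \<and> d2 \<in> D \<inter> M \<and>
          d1 \<otimes>\<^bsub>G\<lparr>carrier := M\<rparr>\<^esub> inv\<^bsub>G\<lparr>carrier := M\<rparr>\<^esub> d2 = g} = 3"
      using count[of g] g by simp
  qed
  then show ?thesis using M card_M by blast
qed

end

section \<open>Level sets of the intersection numbers\<close>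

context odd_diff_set
begin

lemma meet_right_mult:
  assumes H: "subgroup H G" and "g \<in> carrier G" "h \<in> H"
  shows "meet H (g \<otimes> h) = meet H g"
proof -
  have h: "h \<in> carrier G" using assms subgroup.subset by blast
  have "inv d \<otimes> (g \<otimes> h) \<in> H \<longleftrightarrow> inv d \<otimes> g \<in> H" if d: "d \<in> carrier G" for d
  proof
    assume "inv d \<otimes> (g \<otimes> h) \<in> H"
    then have "inv d \<otimes> (g \<otimes> h) \<otimes> inv h \<in> H"
      by (rule subgroup.m_closed[OF H _ subgroup.m_inv_closed[OF H assms(3)]])
    then show "inv d \<otimes> g \<in> H" using d h assms by (simp add: m_assoc)
  next
    assume "inv d \<otimes> g \<in> H"
    then have "inv d \<otimes> g \<otimes> h \<in> H" by (rule subgroup.m_closed[OF H _ assms(3)])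
    then show "inv d \<otimes> (g \<otimes> h) \<in> H" using d h assms by (simp add: m_assoc)
  qed
  then have "{d \<in> D. inv d \<otimes> (g \<otimes> h) \<in> H} = {d \<in> D. inv d \<otimes> g \<in> H}"
    using D_closed by auto
  then show ?thesis by (simp add: meet_def)
qed

text \<open>A level set of \<open>meet H\<close> of the size of \<open>H\<close> is a single coset; being closed under inversion
  it is \<open>H\<close> itself, as the order of the group is odd.\<close>

lemma meet_level:
  assumes H: "subgroup H G" and inv: "\<And>g. g \<in> carrier G \<Longrightarrow> meet H (inv g) = meet H g"
    and card: "card {g \<in> carrier G. meet H g = c} = card H"
  shows "{g \<in> carrier G. meet H g = c} = H" (is "?S = H")
proof -
  have Hc: "h \<in> carrier G" if "h \<in> H" for h using that subgroup.subset[OF H] by blast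
  have finH: "finite H" using finite_subset[OF subgroup.subset[OF H]] by simp
  then have "card H > 0" using subgroup.one_closed[OF H] by (auto simp: card_gt_0_iff)
  then obtain g where g: "g \<in> carrier G" "meet H g = c"
    using card by (metis (mono_tags, lifting) card.empty empty_Collect_eq less_irrefl)
  have "inj_on (\<lambda>h. g \<otimes> h) H" using g Hc by (auto simp: inj_on_def)
  then have "card ((\<lambda>h. g \<otimes> h) ` H) = card ?S" using card by (simp add: card_image)
  moreover have "(\<lambda>h. g \<otimes> h) ` H \<subseteq> ?S" using g Hc meet_right_mult[OF H] by auto
  ultimately have S: "(\<lambda>h. g \<otimes> h) ` H = ?S"
    by (intro card_subset_eq) auto
  have "inv g \<in> ?S" using g inv by simp
  then obtain h where h: "h \<in> H" "inv g = g \<otimes> h" unfolding S[symmetric] by blast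
  have "g \<otimes> g = inv h"
  proof -
    have "g \<otimes> g \<otimes> h = \<one>" using h g Hc[OF h(1)] by (metis m_assoc r_inv)
    then show ?thesis using g Hc[OF h(1)] by (simp add: inv_equality)
  qed
  \<comment> \<open>The square root is a power, so it does not leave the subgroup H.\<close>
  then have "g = sqroot (inv h)" using g sqroot_square by metis
  then have gH: "g \<in> H" unfolding sqroot_def
    using h by (simp add: subgroup_pow[OF H] subgroup.m_inv_closed[OF H])
  have "H \<subseteq> ?S"
  proof
    fix x assume x: "x \<in> H"
    have "inv g \<otimes> x \<in> H" by (intro subgroup.m_closed[OF H] subgroup.m_inv_closed[OF H] gH x)
    then have "g \<otimes> (inv g \<otimes> x) \<in> (\<lambda>h. g \<otimes> h) ` H" by (rule imageI)
    then show "x \<in> ?S" unfolding S using g Hc[OF x] by simp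
  qed
  then show ?thesis using card by (intro card_subset_eq[symmetric]) auto
qed

lemma meet_le_card:
  assumes H: "subgroup H G" and "g \<in> carrier G" shows "meet H g \<le> card H"
  unfolding meet_def
proof (rule card_inj_on_le)
  show "inj_on (\<lambda>d. inv d \<otimes> g) {d \<in> D. inv d \<otimes> g \<in> H}"
    using assms D_closed by (auto simp: inj_on_def)
  show "finite H" using finite_subset[OF subgroup.subset[OF H]] by simp
qed auto

end

subsection \<open>Difference sets with Singer parameters in dimension three\<close>

lemma singer_parameters:
  assumes "s > 0" "q = (2::nat) ^ s"
  shows "(2 ^ (4 * s) - 1) div (2 ^ s - 1) = (q + 1) * (q\<^sup>2 + 1)"
    and "(2 ^ (3 * s) - 1) div (2 ^ s - 1) = q\<^sup>2 + q + 1"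
    and "(2 ^ (2 * s) - 1) div (2 ^ s - 1) = q + 1"
proof -
  have "q > 1" using assms one_less_power[of "2::nat" s] by simp
  \<comment> \<open>With q = r + 1 every numerator becomes an explicit multiple of r, free of
    truncated subtraction; r > 0 makes the division exact.\<close>
  then obtain r where r: "q = Suc r" "r > 0" by (cases q) auto
  have pow: "2 ^ (n * s) = Suc r ^ n" for n
    using assms r by (metis mult.commute power_mult)
  have "Suc r ^ 4 - 1 = r * ((q + 1) * (q\<^sup>2 + 1))" "Suc r ^ 3 - 1 = r * (q\<^sup>2 + q + 1)"
    "Suc r ^ 2 - 1 = r * (q + 1)"
    by (simp_all add: r eval_nat_numeral algebra_simps)
  moreover have "2 ^ s - 1 = r" using assms r by simp
  ultimately show "(2 ^ (4 * s) - 1) div (2 ^ s - 1) = (q + 1) * (q\<^sup>2 + 1)"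
    "(2 ^ (3 * s) - 1) div (2 ^ s - 1) = q\<^sup>2 + q + 1"
    "(2 ^ (2 * s) - 1) div (2 ^ s - 1) = q + 1"
    unfolding pow using r(2) by simp_all
qed

text \<open>Modulo 15, multiplication by 4 swaps 2 and 8, so these are the only residues of q; in
  both cases q^2 is 4.\<close>

lemma odd_power_2_divisibility:
  assumes "odd s" "q = (2::nat) ^ s"
  shows "3 dvd q + 1" "\<not> 5 dvd q + 1" "5 dvd q\<^sup>2 + 1"
proof -
  obtain t where s: "s = 2 * t + 1" using assms by (auto elim: oddE)
  have "(2::nat) ^ (2 * t + 1) mod 15 \<in> {2, 8}"
  proof (induction t)
    case (Suc t)
    have "(2::nat) ^ (2 * Suc t + 1) mod 15 = (4 * (2 ^ (2 * t + 1) mod 15)) mod 15"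
      by (simp add: mod_mult_right_eq)
    then show ?case using Suc by auto
  qed simp
  then have q15: "q mod 15 = 2 \<or> q mod 15 = 8" by (simp add: assms s)
  then show "3 dvd q + 1" "\<not> 5 dvd q + 1" by presburger+
  have "(q\<^sup>2 + 1) mod 15 = ((q mod 15)\<^sup>2 + 1) mod 15"
    by (metis mod_add_left_eq power_mod)
  then have "(q\<^sup>2 + 1) mod 15 = 5" using q15 by auto
  then show "5 dvd q\<^sup>2 + 1" by presburger
qed

section \<open>The subgroups A and B of orders q + 1 and q^2 + 1\<close>

context odd_diff_set
begin

context
  fixes s q :: nat and A B :: "'a set"
  assumes s: "s > 0" and q: "q = 2 ^ s"
    and order: "order G = (q + 1) * (q\<^sup>2 + 1)"
    and k: "k = q\<^sup>2 + q + 1" and lam: "lam = q + 1"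
    and sq_closed: "\<And>d. d \<in> D \<Longrightarrow> d \<otimes> d \<in> D"
    and A_def: "A = torsion (q + 1)" and B_def: "B = torsion (q\<^sup>2 + 1)"
begin

lemma q_ge_2: "q \<ge> 2" and even_q: "even q"
  using s self_le_power[of 2 s] by (simp_all add: q)

lemma k_lam: "k = lam + (2 ^ s)\<^sup>2"
  by (simp add: k lam q)

text \<open>q^2 + 1 = (q + 1) (q - 1) + 2, and q + 1 is odd.\<close>

lemma coprime_q: "coprime (q + 1) (q\<^sup>2 + 1)"
proof -
  have "q\<^sup>2 + 1 = (q + 1) * (q - 1) + 2"
    using q_ge_2 by (cases q) (simp_all add: power2_eq_square)
  then have "gcd (q + 1) (q\<^sup>2 + 1) = gcd (q + 1) 2"
    by (metis gcd_add_mult gcd.commute mult.commute add.commute)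
  also have "\<dots> = 1" using even_q by (simp add: coprime_iff_gcd_eq_1[symmetric])
  finally show ?thesis by (simp add: coprime_iff_gcd_eq_1)
qed

lemma subgroup_A: "subgroup A G" and subgroup_B: "subgroup B G"
  by (simp_all add: A_def B_def subgroup_torsion)

lemma mem_A_iff: "x \<in> carrier G \<Longrightarrow> x \<in> A \<longleftrightarrow> ord x dvd q + 1"
  and mem_B_iff: "x \<in> carrier G \<Longrightarrow> x \<in> B \<longleftrightarrow> ord x dvd q\<^sup>2 + 1"
  unfolding A_def B_def torsion_def using pow_eq_id by blast+

lemma card_A: "card A = q + 1" and card_B: "card B = q\<^sup>2 + 1"
  using card_torsion[OF order coprime_q] card_torsion[of "q\<^sup>2 + 1" "q + 1"] coprime_q order
  by (simp_all add: A_def B_def mult.commute coprime_commute)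

text \<open>The two exponents q^2 + 1 and q + 1 multiply to |G|. Hence q^2 acts as inversion on G/A,
  and q does on G/B.\<close>

lemma pow_mem_A: "g \<in> carrier G \<Longrightarrow> g [^] ((2::nat) ^ (2 * s) + 1) \<in> A"
  and pow_mem_B: "g \<in> carrier G \<Longrightarrow> g [^] ((2::nat) ^ s + 1) \<in> B"
proof -
  assume g: "g \<in> carrier G"
  have eq: "(2::nat) ^ (2 * s) + 1 = q\<^sup>2 + 1" by (simp add: q power_mult[symmetric] mult.commute)
  show "g [^] ((2::nat) ^ (2 * s) + 1) \<in> A" unfolding eq A_def torsion_def
    using g pow_order_eq_1[OF g] order by (simp only: mem_Collect_eq nat_pow_closed nat_pow_pow mult.commute)
  show "g [^] ((2::nat) ^ s + 1) \<in> B" unfolding q[symmetric] B_def torsion_def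
    using g pow_order_eq_1[OF g] order by (simp only: mem_Collect_eq nat_pow_closed nat_pow_pow)
qed

text \<open>Both v and k are 1 modulo q; the factor 1 + q c stands for the order of the subgroup,
  with c = 1 for A and c = q for B.\<close>

lemma dvd_imp_meet:
  assumes "int q dvd int (order G) * int n - int k * (1 + int q * c)"
  shows "\<exists>b::nat. n = 1 + q * b"
proof -
  have "int (order G) * int n - int k * (1 + int q * c) = (int n - 1) +
      int q * (((int q)\<^sup>2 + int q + 1) * int n - (int q + 1) - int k * c)"
    by (simp add: order k power2_eq_square algebra_simps)
  then have "int q dvd int n - 1" using assms by (metis dvd_add_times_triv_right_iff mult.commute)
  then obtain d where d: "int n - 1 = int q * d" by blast
  \<comment> \<open>n \<ge> 0 and q \<ge> 2 exclude negative d, so the quotient is a natural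
    number.\<close>
  have "int q * (d + 1) > 0" using d q_ge_2 by (simp add: algebra_simps)
  then have "d \<ge> 0" by (simp add: zero_less_mult_iff)
  then have "int n = int (1 + q * nat d)" using d by simp
  then show ?thesis using of_nat_eq_iff by blast
qed

lemma meet_A: assumes "g \<in> carrier G" shows "meet A g = 1 \<or> meet A g = q + 1"
proof -
  have "int q dvd int (order G) * int (meet A g) - int k * (1 + int q * 1)"
    using dvd_meet[OF k_lam sq_closed subgroup_A pow_mem_A assms]
    unfolding card_A by (simp add: q)
  then obtain b where b: "meet A g = 1 + q * b" using dvd_imp_meet by blast
  then have "q * b \<le> q * 1" using meet_le_card[OF subgroup_A assms] by (simp add: card_A)
  then have "b \<le> 1" using q_ge_2 by (simp only: nat_mult_le_cancel1) 
  then show ?thesis using b by (cases b) auto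
qed

text \<open>Summing over G gives k (q + 1) = v + q |S| for the level set S, so |S| = q + 1 = |A| and
  \<open>meet_level\<close> applies.\<close>

lemma meet_A_level: "{g \<in> carrier G. meet A g = q + 1} = A" (is "?S = A")
proof (rule meet_level[OF subgroup_A])
  show "meet A (inv g) = meet A g" if "g \<in> carrier G" for g
    using meet_inv[OF k_lam sq_closed subgroup_A pow_mem_A that] .
  have "k * (q + 1) = (\<Sum>g\<in>carrier G. meet A g)"
    using sum_meet[OF subgroup.subset[OF subgroup_A]] unfolding card_A by simp
  also have "\<dots> = (\<Sum>g\<in>carrier G. 1 + q * of_bool (g \<in> ?S))"
    by (rule sum.cong) (use meet_A q_ge_2 in auto)
  also have "\<dots> = order G + q * card ?S"
    by (subst sum.distrib) (simp add: sum_distrib_left[symmetric] order_def Int_def)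
  finally have "q * (q + 1) = q * card ?S" by (simp add: k order power2_eq_square algebra_simps)
  moreover have "q > 0" using q_ge_2 by simp
  ultimately have "q + 1 = card ?S" by (simp only: nat_mult_eq_cancel1)
  then show "card ?S = card A" by (simp add: card_A)
qed

text \<open>At g = 1 the intersection number q + 1 is all of |A|.\<close>

lemma A_subset: "A \<subseteq> D"
proof
  fix a assume a: "a \<in> A"
  let ?T = "{d \<in> D. inv d \<otimes> \<one> \<in> A}"
  have AI: "inv x \<in> A" if "x \<in> A" for x using that by (rule subgroup.m_inv_closed[OF subgroup_A])
  have "\<one> \<in> A" by (rule subgroup.one_closed[OF subgroup_A])
  then have "card ?T = q + 1" using meet_A_level by (auto simp: meet_def)
  moreover have "?T \<subseteq> A" using D_closed AI by force
  moreover have "finite A" by (simp add: A_def torsion_def)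
  ultimately have "?T = A" using card_A by (intro card_subset_eq) auto
  then show "a \<in> D" using a by blast
qed

text \<open>Here the size of B is too weak a bound. With intersection numbers 1 + q b, the first and
  second moments give equal sums of b and of b^2, which forces b to be 0 or 1; the first moment then
  gives the size of the level set.\<close>

lemma meet_B_level: "{g \<in> carrier G. meet B g = 1} = B" (is "?S = B")
proof (rule meet_level[OF subgroup_B])
  show "meet B (inv g) = meet B g" if "g \<in> carrier G" for g
    using meet_inv[OF k_lam sq_closed subgroup_B pow_mem_B that] .
  have "\<exists>b. meet B g = 1 + q * b" if g: "g \<in> carrier G" for g
  proof (rule dvd_imp_meet)
    show "int q dvd int (order G) * int (meet B g) - int k * (1 + int q * int q)"
      using dvd_meet[OF k_lam sq_closed subgroup_B pow_mem_B g]
      unfolding card_B by (simp add: q power2_eq_square add.commute)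
  qed
  then obtain b where b: "meet B g = 1 + q * b g" if "g \<in> carrier G" for g by metis
  have sum1: "order G + q * (\<Sum>g\<in>carrier G. b g) = k * (q\<^sup>2 + 1)"
    proof -
    have "(\<Sum>g\<in>carrier G. meet B g) = (\<Sum>g\<in>carrier G. 1 + q * b g)"
      by (rule sum.cong) (simp_all add: b)
    also have "\<dots> = order G + q * (\<Sum>g\<in>carrier G. b g)"
      by (subst sum.distrib) (simp add: sum_distrib_left order_def)
    finally show ?thesis
      using sum_meet[OF subgroup.subset[OF subgroup_B]] unfolding card_B by simp
  qed
  then have "q * (\<Sum>g\<in>carrier G. b g) = q * (q * (q\<^sup>2 + 1))"
    by (simp add: k order power2_eq_square algebra_simps)
  then have sumb: "(\<Sum>g\<in>carrier G. b g) = q * (q\<^sup>2 + 1)" using q_ge_2 by simp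
  have "(\<Sum>g\<in>carrier G. (1 + q * b g)\<^sup>2) = (q\<^sup>2 + 1) * (q\<^sup>2 + lam * (q\<^sup>2 + 1))"
    using sum_meet_square[OF k_lam sq_closed subgroup_B pow_mem_B] unfolding card_B
    by (simp add: b q[symmetric])
  moreover have "(\<Sum>g\<in>carrier G. (1 + q * b g)\<^sup>2)
      = order G + 2 * q * (\<Sum>g\<in>carrier G. b g) + q\<^sup>2 * (\<Sum>g\<in>carrier G. (b g)\<^sup>2)"
  proof -
    have "(\<Sum>g\<in>carrier G. (1 + q * b g)\<^sup>2)
        = (\<Sum>g\<in>carrier G. 1 + (2 * q * b g + q\<^sup>2 * (b g)\<^sup>2))"
      by (intro sum.cong refl) (simp add: power2_eq_square algebra_simps)
    then show ?thesis
      by (simp only: sum.distrib sum_distrib_left) (simp add: order_def)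
  qed
  ultimately have "q\<^sup>2 * (\<Sum>g\<in>carrier G. (b g)\<^sup>2) = q\<^sup>2 * (q * (q\<^sup>2 + 1))"
    unfolding sumb by (simp add: lam order power2_eq_square algebra_simps)
  then have "(\<Sum>g\<in>carrier G. (b g)\<^sup>2) = (\<Sum>g\<in>carrier G. b g)"
    using q_ge_2 sumb by simp
  then have "int (\<Sum>g\<in>carrier G. (b g)\<^sup>2) - int (\<Sum>g\<in>carrier G. b g) = 0" by simp
  then have "(\<Sum>g\<in>carrier G. (int (b g))\<^sup>2 - int (b g)) = 0"
    by (simp add: sum_subtractf)
  \<comment> \<open>n^2 \<ge> n for natural n, so a vanishing sum of the differences vanishes term
    by term.\<close>
  moreover have nonneg: "(int n)\<^sup>2 - int n \<ge> 0" for n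
    by (cases n) (simp_all add: power2_eq_square)
  ultimately have "\<forall>g\<in>carrier G. (int (b g))\<^sup>2 - int (b g) = 0"
    by (subst (asm) sum_nonneg_eq_0_iff) auto
  then have b01: "b g = of_bool (g \<notin> ?S)" if "g \<in> carrier G" for g
    using that b[OF that] q_ge_2 by (auto simp: power2_eq_square)
  have "(\<Sum>g\<in>carrier G. b g) = card (carrier G - ?S)"
  proof -
    have "(\<Sum>g\<in>carrier G. b g) = (\<Sum>g\<in>carrier G. of_bool (g \<notin> ?S))"
      by (rule sum.cong) (simp_all only: b01)
    also have "\<dots> = card (carrier G \<inter> {g. g \<notin> ?S})" by (subst sum_of_bool_eq) simp_all
    also have "carrier G \<inter> {g. g \<notin> ?S} = carrier G - ?S" by blast
    finally show ?thesis .
  qed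
  also have "\<dots> = order G - card ?S" by (simp add: card_Diff_subset order_def)
  finally have "order G - card ?S = q * (q\<^sup>2 + 1)" by (simp add: sumb)
  moreover have "card ?S \<le> order G" by (simp add: order_def card_mono)
  ultimately show "card ?S = card B" by (simp add: card_B order)
qed

lemma D_inter_B: "D \<inter> B = {\<one>}"
proof -
  have BI: "inv x \<in> B \<longleftrightarrow> x \<in> B" if "x \<in> carrier G" for x
    using that by (metis inv_inv subgroup.m_inv_closed[OF subgroup_B])
  have oneB: "\<one> \<in> B" by (rule subgroup.one_closed[OF subgroup_B])
  have "{d \<in> D. inv d \<otimes> \<one> \<in> B} = D \<inter> B" using D_closed BI by auto
  moreover have "meet B \<one> = 1" using oneB meet_B_level by auto
  ultimately have "card (D \<inter> B) = 1" by (simp add: meet_def)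
  moreover have "\<one> \<in> D \<inter> B"
    using oneB A_subset subgroup.one_closed[OF subgroup_A] by blast
  ultimately show ?thesis by (metis card_1_singletonE singletonD)
qed

section \<open>An element of order 15 in D and its powers\<close>

lemma A_coset_unique:
  assumes "d \<in> D" "d' \<in> D" "d \<notin> A" "inv d' \<otimes> d \<in> A"
  shows "d = d'"
proof -
  have "meet A d = 1" using meet_A[of d] meet_A_level assms D_closed by blast
  then obtain y where "{e \<in> D. inv e \<otimes> d \<in> A} = {y}"
    unfolding meet_def by (rule card_1_singletonE)
  moreover have "inv d \<otimes> d \<in> A"
    using assms D_closed subgroup.one_closed[OF subgroup_A] by simp
  then have "d \<in> {e \<in> D. inv e \<otimes> d \<in> A}" "d' \<in> {e \<in> D. inv e \<otimes> d \<in> A}"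
    using assms by blast+
  ultimately show ?thesis by (metis singletonD)
qed

text \<open>B has an element b of order 5, which is not in A, so the coset b A contains exactly one
  point x of D. The multiplier 16 maps D to itself and fixes this coset, hence x^16 = x.\<close>

lemma exists_order_15:
  assumes "odd s"
  shows "\<exists>x\<in>D. ord x = 15"
proof -
  note q3 = odd_power_2_divisibility(1)[OF \<open>odd s\<close> q]
    and q5 = odd_power_2_divisibility(2)[OF \<open>odd s\<close> q]
    and q25 = odd_power_2_divisibility(3)[OF \<open>odd s\<close> q]
  have "Factorial_Ring.prime (5::nat)" by simp
  then obtain b where b: "b \<in> B" "b \<noteq> \<one>" "b [^] (5::nat) = \<one>"
    using cauchy_subgroup[OF subgroup_B, of 5] q25 card_B by auto
  have bc: "b \<in> carrier G" using b subgroup.subset[OF subgroup_B] by blast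
  have bA: "b \<notin> A"
  proof
    assume "b \<in> A"
    then have "ord b dvd q + 1" "ord b dvd 5" using b bc by (auto simp: mem_A_iff pow_eq_id simp del: Suc_eq_plus1)
    then have "ord b = 1" using q5 \<open>Factorial_Ring.prime (5::nat)\<close> by (metis prime_nat_iff)
    then show False using b bc ord_eq_1 by blast
  qed
  then have "meet A b = 1" using meet_A[OF bc] meet_A_level bc by blast
  then obtain x where "{d \<in> D. inv d \<otimes> b \<in> A} = {x}"
    unfolding meet_def by (rule card_1_singletonE)
  then have x: "x \<in> D" "inv x \<otimes> b \<in> A" by auto
  have xc: "x \<in> carrier G" using x D_closed by simp
  define a where "a = inv x \<otimes> b"
  have ac: "a \<in> carrier G" by (simp add: a_def xc bc)
  have xa: "x = b \<otimes> inv a" using xc bc by (simp add: a_def inv_mult_group)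
  have AI: "inv a \<in> A" using x by (simp add: a_def subgroup.m_inv_closed[OF subgroup_A])
  have xA: "x \<notin> A"
  proof
    assume "x \<in> A"
    then have "x \<otimes> a \<in> A" using x by (intro subgroup.m_closed[OF subgroup_A]) (auto simp: a_def)
    then show False using bA xc bc by (simp add: a_def)
  qed
  have "b [^] (15::nat) = \<one>" using b bc nat_pow_pow[OF bc, of 5 3] by simp
  then have "x [^] (15::nat) = inv a [^] (15::nat)"
    using bc ac by (simp add: xa pow_mult_distrib m_comm)
  then have x15A: "x [^] (15::nat) \<in> A" using subgroup_pow[OF subgroup_A AI] by simp
  have "x [^] (16::nat) = x"
  proof (rule A_coset_unique[symmetric])
    show "x [^] (16::nat) \<in> D" using pow2_mem[OF sq_closed x(1), of 4] by simp
    have "x [^] (16::nat) = x [^] (15::nat) \<otimes> x" using nat_pow_Suc[of x 15] by simp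
    then have "inv (x [^] (16::nat)) \<otimes> x = inv (x [^] (15::nat))"
      using xc by (simp add: inv_mult m_assoc)
    then show "inv (x [^] (16::nat)) \<otimes> x \<in> A"
      using x15A by (simp add: subgroup.m_inv_closed[OF subgroup_A])
  qed (use x xA in auto)
  then have "x [^] (15::nat) \<otimes> x = x" using nat_pow_Suc[of x 15] by simp
  then have "x [^] (15::nat) = \<one>" using xc by simp
  then have "ord x dvd 15" using xc by (simp add: pow_eq_id)
  \<comment> \<open>3 divides q + 1, so such an order would put x in A.\<close>
  moreover have "\<not> ord x dvd 3"
    using xA xc q3 dvd_trans mem_A_iff by blast
  \<comment> \<open>5 divides q^2 + 1, so such an order would put x in B, where D has only the
    identity.\<close>
  moreover have "\<not> ord x dvd 5"
  proof
    assume "ord x dvd 5"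
    then have "x \<in> D \<inter> B" using x xc q25 dvd_trans mem_B_iff by blast
    then show False using D_inter_B xA subgroup.one_closed[OF subgroup_A] by auto
  qed
  moreover have "n = 15" if n: "n dvd 15" "\<not> n dvd 3" "\<not> n dvd 5" for n :: nat
  proof -
    have "n \<in> {0, 1, 2, 3, 4, 5, 6, 7, 8, 9, 10, 11, 12, 13, 14, 15}"
      using dvd_imp_le[OF n(1)] by simp presburger
    then show ?thesis using n by auto
  qed
  ultimately have "ord x = 15" by blast
  then show ?thesis using x by blast
qed

text \<open>The exponents 0, 5, 10 give elements of A, and 1, 2, 4, 8 come from the multiplier 2.
  Other multiples of 3 give nontrivial elements of B, outside D. The remaining 7, 11, 13, 14 share
  their A-coset with 2, 1, 8, 4.\<close>

lemma pow_mem_iff: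
  assumes "odd s" and x: "x \<in> D" "ord x = 15" and i: "i < 15"
  shows "x [^] i \<in> D \<longleftrightarrow> i \<in> {0, 1, 2, 4, 5, 8, 10 :: nat}"
proof -
  note q3 = odd_power_2_divisibility(1)[OF \<open>odd s\<close> q]
    and q5 = odd_power_2_divisibility(2)[OF \<open>odd s\<close> q]
    and q25 = odd_power_2_divisibility(3)[OF \<open>odd s\<close> q]
  have xc: "x \<in> carrier G" using x D_closed by simp
  have one: "x [^] n = \<one> \<longleftrightarrow> 15 dvd n" for n :: nat using xc x by (simp add: pow_eq_id)
  have A: "x [^] n \<in> A \<longleftrightarrow> 5 dvd n" for n :: nat
  proof -
    have "x [^] n \<in> A \<longleftrightarrow> 15 dvd n * (q + 1)"
      using xc by (simp only: A_def torsion_def mem_Collect_eq nat_pow_closed nat_pow_pow one simp_thms)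
    also have "\<dots> \<longleftrightarrow> 5 dvd n"
    proof
      assume "15 dvd n * (q + 1)"
      then have "5 dvd n * (q + 1)" by (rule dvd_trans[rotated]) simp
      then show "5 dvd n" using q5 prime_dvd_mult_iff[of "5::nat" n "q + 1"] by simp
    next
      assume "5 dvd n"
      then show "15 dvd n * (q + 1)" using mult_dvd_mono[OF _ q3, of 5 n] by simp
    qed
    finally show ?thesis .
  qed
  have B: "x [^] n \<in> B" if "3 dvd n" for n :: nat
    using xc mult_dvd_mono[OF that q25]
    by (simp only: B_def torsion_def mem_Collect_eq nat_pow_closed nat_pow_pow one simp_thms) simp
  have in_A: "x [^] n \<in> D" if "5 dvd n" for n :: nat using A that A_subset by blast
  have two: "x [^] (2 ^ j :: nat) \<in> D" for j using pow2_mem[OF sq_closed x(1)] .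
  have not_B: "x [^] n \<notin> D" if "3 dvd n" "\<not> 15 dvd n" for n :: nat
    using B[OF that(1)] D_inter_B one that(2) by blast
  \<comment> \<open>x^(5 l) lies in A and is not 1, so x^n and x^(n + 5 l) are distinct points of
    one coset other than A, which has only one point of D.\<close>
  have not_pair: "x [^] (n + 5 * l) \<notin> D" if "x [^] n \<in> D" "\<not> 5 dvd n" "\<not> 3 dvd l" for n l :: nat
  proof
    assume "x [^] (n + 5 * l) \<in> D"
    moreover have add: "x [^] (n + 5 * l) = x [^] n \<otimes> x [^] (5 * l)" using xc by (simp add: nat_pow_mult)
    moreover have "x [^] (n + 5 * l) \<notin> A" using A that(2) by (simp add: dvd_add_left_iff)
    moreover have "inv (x [^] n) \<otimes> x [^] (n + 5 * l) \<in> A" using add A xc by simp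
    ultimately have "x [^] (n + 5 * l) = x [^] n" using A_coset_unique that(1) by blast
    then have "x [^] (5 * l) = \<one>" using add xc by simp
    then have "15 dvd 5 * l" by (simp only: one)
    then show False using that(3) by presburger
  qed
  have "x [^] i \<in> D" if "i \<in> {0, 1, 2, 4, 5, 8, 10}"
    using that in_A[of 0] in_A[of 5] in_A[of 10] two[of 0] two[of 1] two[of 2] two[of 3] by auto
  moreover have "x [^] i \<notin> D" if "i \<in> {3, 6, 9, 12, 7, 11, 13, 14}"
    using that not_B[of 3] not_B[of 6] not_B[of 9] not_B[of 12]
      not_pair[OF two[of 1], of 1] not_pair[OF two[of 0], of 2]
      not_pair[OF two[of 3], of 1] not_pair[OF two[of 2], of 2] by auto
  moreover have "i \<in> {0, 1, 2, 4, 5, 8, 10} \<or> i \<in> {3, 6, 9, 12, 7, 11, 13, 14}"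
    using i by simp presburger
  ultimately show ?thesis by blast
qed

end

end

theorem theorem6p1:
  fixes G :: "('a, 'b) monoid_scheme" and D :: "'a set" and s :: nat
  assumes "odd s" and "s > 0"
    and "difference_set G D ((2^(4*s) - 1) div (2^s - 1)) ((2^(3*s) - 1) div (2^s - 1))
           ((2^(2*s) - 1) div (2^s - 1))"
    and "normalized_difference_set G D"
  shows "\<exists>M. subgroup M G \<and> card M = 15 \<and>
           difference_set (G\<lparr>carrier := M\<rparr>) (D \<inter> M) 15 7 3"
proof -
  define q :: nat where "q = 2 ^ s"
  note par = singer_parameters[OF \<open>s > 0\<close> q_def]
  have ds: "difference_set G D ((q + 1) * (q\<^sup>2 + 1)) (q\<^sup>2 + q + 1) (q + 1)"
    using assms(3) unfolding par .
  then have order: "order G = (q + 1) * (q\<^sup>2 + 1)"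
    by (simp add: difference_set_def order_def)
  interpret comm_group G using ds by (simp add: difference_set_def)
  have "even q" using \<open>s > 0\<close> by (simp add: q_def)
  interpret odd_diff_set G D "q\<^sup>2 + q + 1" "q + 1"
    by unfold_locales (use ds order \<open>even q\<close> in \<open>auto simp: difference_set_def order_def\<close>)
  \<comment> \<open>k - lambda = q^2 is the power of two with exponent e = 2 s in
    \<open>square_mem\<close>.\<close>
  have "q\<^sup>2 + q + 1 = (q + 1) + 2 ^ (2 * s)" by (simp add: q_def power_mult[symmetric] mult.commute)
  moreover have "q + 1 < 2 ^ (2 * s)"
  proof -
    have "q \<ge> 2" using \<open>s > 0\<close> self_le_power[of 2 s] by (simp add: q_def)
    then have "q + 1 < q * q" using mult_le_mono1[of 2 q q] by linarith
    then show ?thesis by (simp add: q_def power_mult power2_eq_square mult_2 power_add)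
  qed
  moreover have "coprime (q\<^sup>2 + q + 1) (order G)"
  proof -
    \<comment> \<open>v = q k + 1, so v and k are coprime.\<close>
    have "order G = q * (q\<^sup>2 + q + 1) + 1" by (simp add: order power2_eq_square algebra_simps)
    then show ?thesis by (metis coprime_1_right coprime_iff_gcd_eq_1 gcd_add_mult add.commute)
  qed
  ultimately have sq_closed: "d \<otimes>\<^bsub>G\<^esub> d \<in> D" if "d \<in> D" for d
    using square_mem assms(4) that by blast
  note ctx = \<open>s > 0\<close> q_def order refl refl sq_closed refl refl
  obtain x where x: "x \<in> D" "ord x = 15"
    using exists_order_15[OF ctx \<open>odd s\<close>] by blast
  show ?thesis
    by (rule difference_set_15_7_3[of x]) (use x D_closed pow_mem_iff[OF ctx \<open>odd s\<close> x] in auto)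
qed

end
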